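(* Let $n\ge 3$, let $\Omega\subset\mathbb{R}^n$ be a bounded convex domain, and let $c\in\mathbb{R}$ with $c\neq 0$. Then there does not exist an integrable function $f:\Omega\to\mathbb{R}$ such that $$\int_{\Omega\cap\Sigma} f(x)\,d\mathcal{H}^{n-1}(x)=c$$ for all $(n-1)$-dimensional hyperplanes $\Sigma\subset\mathbb{R}^n$ satisfying $\mathcal{H}^{n-1}(\Omega\cap\Sigma)>0$.
   Context: A domain is a nonempty connected open set. $\mathcal{H}^{n-1}$ denotes $(n-1)$-dimensional Hausdorff measure. "Hyperplane" means affine hyperplane. *)

theory Defs
  imports "HOL-Analysis.Analysis"
begin

(* For A = {} the weight is 0 also when s = 0, where (diameter {} / 2) ^ 0 = 1.  The factor
   unit_ball_vol s is the usual normalisation, under which the s-dimensional Hausdorff measure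
   on R^s is Lebesgue measure. *)
definition hausdorff_weight :: "nat \<Rightarrow> 'a::metric_space set \<Rightarrow> ennreal" where
  "hausdorff_weight s A =
     (if A = {} then 0 else ennreal (unit_ball_vol (real s) * (diameter A / 2) ^ s))"

(* Boundedness must be required separately: diameter is unspecified on unbounded sets. *)
definition hausdorff_content :: "nat \<Rightarrow> real \<Rightarrow> 'a::metric_space set \<Rightarrow> ennreal" where
  "hausdorff_content s \<delta> A =
     (INF C \<in> {C :: nat \<Rightarrow> 'a set. A \<subseteq> (\<Union>i. C i) \<and> (\<forall>i. bounded (C i) \<and> diameter (C i) \<le> \<delta>)}.
        \<Sum>i. hausdorff_weight s (C i))"

definition hausdorff_outer_measure :: "nat \<Rightarrow> 'a::metric_space set \<Rightarrow> ennreal" where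
  "hausdorff_outer_measure s A = (SUP \<delta>\<in>{0<..}. hausdorff_content s \<delta> A)"

(* Domain of definition: all sets satisfying Caratheodory's measurability criterion. *)
definition hausdorff_measure :: "nat \<Rightarrow> 'a::metric_space measure" where
  "hausdorff_measure s =
     measure_of UNIV (lambda_system UNIV UNIV (hausdorff_outer_measure s))
       (hausdorff_outer_measure s)"

lemma hausdorff_weight_empty [simp]: "hausdorff_weight s {} = 0"
  by (simp add: hausdorff_weight_def)

lemma hausdorff_content_empty:
  assumes "\<delta> > 0" shows "hausdorff_content s \<delta> ({} :: 'a::metric_space set) = 0"
proof -
  have "hausdorff_content s \<delta> ({} :: 'a set) \<le> (\<Sum>i::nat. hausdorff_weight s ({} :: 'a set))"
    unfolding hausdorff_content_def by (rule INF_lower) (use assms in auto)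
  then show ?thesis by simp
qed

lemma hausdorff_content_mono:
  "A \<subseteq> B \<Longrightarrow> hausdorff_content s \<delta> A \<le> hausdorff_content s \<delta> B"
  unfolding hausdorff_content_def by (rule INF_superset_mono) auto

lemma hausdorff_content_UN_le:
  fixes A :: "nat \<Rightarrow> 'a::metric_space set"
  shows "hausdorff_content s \<delta> (\<Union>i. A i) \<le> (\<Sum>i. hausdorff_content s \<delta> (A i))"
proof (rule ennreal_le_epsilon)
  fix e :: real
  assume fin: "(\<Sum>i. hausdorff_content s \<delta> (A i)) < top" and e: "0 < e"
  let ?Cov = "\<lambda>X C. X \<subseteq> (\<Union>i. C i) \<and> (\<forall>i::nat. bounded (C i) \<and> diameter (C i) \<le> \<delta>)"
  have "\<exists>C. ?Cov (A n) C \<and>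
      (\<Sum>i. hausdorff_weight s (C i)) \<le> hausdorff_content s \<delta> (A n) + ennreal (e * (1/2) ^ Suc n)"
    for n
  proof -
    have "hausdorff_content s \<delta> (A n) \<noteq> top"
      using fin ennreal_suminf_lessD less_top by fastforce
    then have "hausdorff_content s \<delta> (A n)
        < hausdorff_content s \<delta> (A n) + ennreal (e * (1/2) ^ Suc n)"
      using e by (simp add: ennreal_add_left_cancel_less less_top)
    then show ?thesis
      by (subst (asm) (1) hausdorff_content_def) (auto simp: INF_less_iff intro: less_imp_le)
  qed
  then obtain C where C: "\<And>n. ?Cov (A n) (C n)"
    and le: "\<And>n. (\<Sum>i. hausdorff_weight s (C n i))
      \<le> hausdorff_content s \<delta> (A n) + ennreal (e * (1/2) ^ Suc n)"
    by metis
  define D where "D = (\<lambda>k. case prod_decode k of (n, i) \<Rightarrow> C n i)"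
  have "x \<in> (\<Union>k. D k)" if x: "x \<in> A n" for n x
  proof -
    obtain i where "x \<in> C n i" using C[of n] x by blast
    then have "x \<in> D (prod_encode (n, i))" by (simp add: D_def)
    then show ?thesis by blast
  qed
  moreover have "bounded (D k)" "diameter (D k) \<le> \<delta>" for k
    using C by (auto simp: D_def split: prod.split)
  ultimately have "hausdorff_content s \<delta> (\<Union>i. A i) \<le> (\<Sum>k. hausdorff_weight s (D k))"
    unfolding hausdorff_content_def by (intro INF_lower) auto
  also have "\<dots> = (\<Sum>k. case prod_decode k of (n, i) \<Rightarrow> hausdorff_weight s (C n i))"
    by (intro suminf_cong) (simp add: D_def split: prod.split)
  also have "\<dots> = (\<Sum>n. \<Sum>i. hausdorff_weight s (C n i))"
    using suminf_ennreal_2dimen[of "\<lambda>n. \<Sum>i. hausdorff_weight s (C n i)"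
        "\<lambda>(n, i). hausdorff_weight s (C n i)"] by simp
  also have "\<dots> \<le> (\<Sum>n. hausdorff_content s \<delta> (A n) + ennreal (e * (1/2) ^ Suc n))"
    by (intro suminf_le le) auto
  also have "\<dots> = (\<Sum>n. hausdorff_content s \<delta> (A n)) + (\<Sum>n. ennreal (e * (1/2) ^ Suc n))"
    by (subst suminf_add) auto
  also have "(\<Sum>n. ennreal (e * (1/2) ^ Suc n)) = ennreal e"
    using e sums_mult[OF power_half_series, of e]
    by (intro suminf_ennreal_eq) auto
  finally show "hausdorff_content s \<delta> (\<Union>i. A i) \<le> (\<Sum>i. hausdorff_content s \<delta> (A i)) + ennreal e" .
qed

lemma outer_measure_space_hausdorff:
  "outer_measure_space UNIV (hausdorff_outer_measure s :: 'a::metric_space set \<Rightarrow> ennreal)"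
  unfolding outer_measure_space_def
proof (intro conjI)
  show "positive UNIV (hausdorff_outer_measure s :: 'a set \<Rightarrow> ennreal)"
    by (simp add: positive_def hausdorff_outer_measure_def hausdorff_content_empty
        cong: SUP_cong_simp)
  show "increasing UNIV (hausdorff_outer_measure s :: 'a set \<Rightarrow> ennreal)"
    by (auto simp: increasing_def hausdorff_outer_measure_def
        intro!: SUP_mono' hausdorff_content_mono)
  show "countably_subadditive UNIV (hausdorff_outer_measure s :: 'a set \<Rightarrow> ennreal)"
    unfolding countably_subadditive_def
  proof (intro allI impI)
    fix A :: "nat \<Rightarrow> 'a set"
    show "hausdorff_outer_measure s (\<Union>i. A i) \<le> (\<Sum>i. hausdorff_outer_measure s (A i))"
      unfolding hausdorff_outer_measure_def[of s "\<Union>i. A i"]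
    proof (rule SUP_least)
      fix \<delta> :: real assume "\<delta> \<in> {0<..}"
      then have "(\<Sum>i. hausdorff_content s \<delta> (A i)) \<le> (\<Sum>i. hausdorff_outer_measure s (A i))"
        unfolding hausdorff_outer_measure_def by (intro suminf_le SUP_upper) auto
      then show "hausdorff_content s \<delta> (\<Union>i. A i) \<le> (\<Sum>i. hausdorff_outer_measure s (A i))"
        by (rule order_trans[OF hausdorff_content_UN_le])
    qed
  qed
qed

lemma measure_space_hausdorff:
  "measure_space UNIV (lambda_system UNIV UNIV (hausdorff_outer_measure s))
     (hausdorff_outer_measure s :: 'a::metric_space set \<Rightarrow> ennreal)"
proof -
  interpret sigma_algebra "UNIV :: 'a set" UNIV
    using sigma_algebra_Pow[of "UNIV :: 'a set"] by simp
  show ?thesis by (rule caratheodory_lemma[OF outer_measure_space_hausdorff])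
qed

lemma space_hausdorff_measure [simp]: "space (hausdorff_measure s) = UNIV"
  by (simp add: hausdorff_measure_def space_measure_of_conv)

lemma sets_hausdorff_measure:
  "sets (hausdorff_measure s) = lambda_system UNIV UNIV (hausdorff_outer_measure s)"
proof -
  have "sigma_algebra UNIV (lambda_system UNIV UNIV (hausdorff_outer_measure s :: 'a set \<Rightarrow> ennreal))"
    using measure_space_hausdorff by (auto simp: measure_space_def)
  then show ?thesis
    unfolding hausdorff_measure_def by (rule sigma_algebra.sets_measure_of_eq)
qed

lemma emeasure_hausdorff_measure:
  fixes A :: "'a::metric_space set"
  assumes "A \<in> sets (hausdorff_measure s)"
  shows "emeasure (hausdorff_measure s) A = hausdorff_outer_measure s A"
proof -
  let ?H = "hausdorff_outer_measure s :: 'a set \<Rightarrow> ennreal"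
  let ?L = "lambda_system UNIV UNIV ?H"
  have "sigma_algebra UNIV ?L" "positive ?L ?H" "countably_additive ?L ?H"
    using measure_space_hausdorff[of s, where 'a = 'a] by (auto simp: measure_space_def)
  moreover have "A \<in> ?L"
    using assms by (simp add: sets_hausdorff_measure)
  ultimately show ?thesis
    unfolding hausdorff_measure_def by (rule emeasure_measure_of_sigma)
qed

end

theory Submission
  imports Defs
begin

text \<open>Suppose that \<open>f\<close> has integral \<open>c\<close> over every hyperplane section of \<open>\<Omega>\<close>. For a unit
  vector \<open>\<theta>\<close> let \<open>{a<..<b}\<close> be the image of \<open>\<Omega>\<close> under \<open>x \<mapsto> \<theta> \<bullet> x\<close>. Slicing \<open>\<Omega>\<close> orthogonally to \<open>\<theta>\<close>
  gives, with a constant \<open>C \<noteq> 0\<close> that does not depend on \<open>\<theta>\<close>,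
  the identity \<open>\<integral>\<^sub>\<Omega> f x * g (\<theta> \<bullet> x) dx = C * \<integral>\<^sub>a\<^sup>b g t dt\<close> for test functions \<open>g\<close>
  (\<open>direction_slicing\<close>). Three choices of \<open>g\<close> lead to a contradiction.

  The choice \<open>g t = 1\<close> shows that \<open>b - a\<close> is the same number \<open>2 * R\<close> for all \<open>\<theta>\<close>. The choice
  \<open>g t = t\<close> shows that \<open>b\<^sup>2 - a\<^sup>2\<close>, and hence the midpoint of the interval, depends linearly on \<open>\<theta>\<close>.
  Together they say that the interval is the one belonging to the ball of some centre \<open>z\<close> and
  radius \<open>R\<close>, so \<open>\<Omega>\<close> lies in that ball. The indicator function of \<open>{b - e<..}\<close>, finally, shows that \<open>f\<close>
  has integral \<open>C * e\<close> over every cap of height \<open>e\<close>. In dimension at least three the sphere has room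
  for about \<open>1 / e\<close> disjoint caps of height \<open>e\<close>, whereas the shell containing all of them carries
  less and less of the integral of \<open>\<bar>f\<bar>\<close> (\<open>cap_integral_contradiction\<close>). In the plane there is room
  only for about \<open>1 / sqrt e\<close> caps; indeed \<open>1 / sqrt (1 - norm x ^ 2)\<close> has constant integrals over the
  chords of the unit disc.

  The slicing identity needs to know that Hausdorff measure on hyperplanes is a fixed positive
  multiple of Lebesgue measure. To see this, the areas of the sections of a set by the hyperplanes
  orthogonal to one axis are integrated over the height. The result is a translation invariant
  measure on the whole space (\<open>distr_stacked_measure_translate\<close>), hence a multiple of Lebesgue
  measure (\<open>translation_invariant_eq_lborel\<close>). The multiple is positive and finite because a facet
  of a cube has positive finite Hausdorff measure. Other directions are reduced to that axis by
  a rotation.\<close>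

section \<open>Borel sets and isometries for Hausdorff measures\<close>

lemma hausdorff_content_antimono:
  "d \<le> e \<Longrightarrow> hausdorff_content s e A \<le> hausdorff_content s d A"
  unfolding hausdorff_content_def by (rule INF_superset_mono) (auto intro: order_trans)

lemma hausdorff_outer_measure_eq_SUP:
  assumes "0 < e"
  shows "hausdorff_outer_measure s A = (SUP k::nat. hausdorff_content s (e / Suc k) A)"
proof (rule antisym)
  show "hausdorff_outer_measure s A \<le> (SUP k::nat. hausdorff_content s (e / Suc k) A)"
    unfolding hausdorff_outer_measure_def
  proof (rule SUP_least)
    fix d :: real assume d: "d \<in> {0<..}"
    obtain k :: nat where "e / d < k" using reals_Archimedean2 by blast
    then have "e / Suc k \<le> d" using d by (simp add: field_simps)
    then show "hausdorff_content s d A \<le> (SUP k::nat. hausdorff_content s (e / Suc k) A)"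
      by (intro SUP_upper2[of k]) (auto intro: hausdorff_content_antimono)
  qed
  show "(SUP k::nat. hausdorff_content s (e / Suc k) A) \<le> hausdorff_outer_measure s A"
    unfolding hausdorff_outer_measure_def using assms by (intro SUP_mono) auto
qed

text \<open>A covering set of diameter at most \<open>d\<close> cannot meet two sets more than \<open>d\<close> apart, so
  every cover of the union splits into a cover of each part.\<close>

lemma hausdorff_content_separated:
  assumes d: "0 \<le> d" and sep: "\<And>a b. a \<in> A \<Longrightarrow> b \<in> B \<Longrightarrow> d < dist a b"
  shows "hausdorff_content s d A + hausdorff_content s d B \<le> hausdorff_content s d (A \<union> B)"
  unfolding hausdorff_content_def[of s d "A \<union> B"]
proof (rule INF_greatest)
  fix C :: "nat \<Rightarrow> 'a set"
  assume "C \<in> {C. A \<union> B \<subseteq> (\<Union>i. C i) \<and> (\<forall>i. bounded (C i) \<and> diameter (C i) \<le> d)}"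
  then have cov: "A \<union> B \<subseteq> (\<Union>i. C i)" and bd: "\<And>i. bounded (C i)" and dm: "\<And>i. diameter (C i) \<le> d"
    by auto
  define CA where "CA i = (if C i \<inter> A \<noteq> {} then C i else {})" for i
  define CB where "CB i = (if C i \<inter> A \<noteq> {} then {} else C i)" for i
  have "A \<subseteq> (\<Union>i. CA i)" using cov unfolding CA_def by fastforce
  then have "hausdorff_content s d A \<le> (\<Sum>i. hausdorff_weight s (CA i))"
    unfolding hausdorff_content_def using bd dm d by (intro INF_lower) (auto simp: CA_def)
  moreover have "b \<in> (\<Union>i. CB i)" if b: "b \<in> B" for b
  proof -
    obtain i where i: "b \<in> C i" using cov b by blast
    have "C i \<inter> A = {}"
    proof (rule ccontr)
      assume "C i \<inter> A \<noteq> {}"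
      then obtain a where a: "a \<in> C i" "a \<in> A" by blast
      have "dist a b \<le> diameter (C i)" using diameter_bounded_bound[OF bd a(1) i] .
      then show False using sep[OF a(2) b] dm[of i] by simp
    qed
    then show ?thesis using i by (auto simp: CB_def)
  qed
  then have "hausdorff_content s d B \<le> (\<Sum>i. hausdorff_weight s (CB i))"
    unfolding hausdorff_content_def using bd dm d by (intro INF_lower) (auto simp: CB_def)
  ultimately have "hausdorff_content s d A + hausdorff_content s d B
      \<le> (\<Sum>i. hausdorff_weight s (CA i)) + (\<Sum>i. hausdorff_weight s (CB i))"
    by (rule add_mono)
  also have "\<dots> = (\<Sum>i. hausdorff_weight s (CA i) + hausdorff_weight s (CB i))"
    by (rule suminf_add) auto
  also have "\<dots> = (\<Sum>i. hausdorff_weight s (C i))"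
    by (intro suminf_cong) (auto simp: CA_def CB_def)
  finally show "hausdorff_content s d A + hausdorff_content s d B \<le> (\<Sum>i. hausdorff_weight s (C i))" .
qed

lemma hausdorff_outer_measure_separated:
  assumes e: "0 < e" and sep: "\<And>a b. a \<in> A \<Longrightarrow> b \<in> B \<Longrightarrow> e \<le> dist a b"
  shows "hausdorff_outer_measure s A + hausdorff_outer_measure s B \<le> hausdorff_outer_measure s (A \<union> B)"
proof -
  have inc: "incseq (\<lambda>k. hausdorff_content s (e / 2 / Suc k) X)" for X :: "'a set"
    using e by (intro incseq_SucI hausdorff_content_antimono) (auto simp: field_simps)
  have lt: "e / 2 / Suc k < e" for k
  proof -
    have "e / 2 / Suc k \<le> e / 2 / 1" using e by (intro divide_left_mono) auto
    also have "\<dots> < e" using e by simp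
    finally show ?thesis .
  qed
  have "hausdorff_outer_measure s A + hausdorff_outer_measure s B =
     (SUP k. hausdorff_content s (e / 2 / Suc k) A) + (SUP k. hausdorff_content s (e / 2 / Suc k) B)"
    using e by (simp add: hausdorff_outer_measure_eq_SUP[of "e / 2"])
  also have "\<dots> = (SUP k. hausdorff_content s (e / 2 / Suc k) A + hausdorff_content s (e / 2 / Suc k) B)"
    by (rule ennreal_SUP_add[symmetric]) (rule inc)+
  also have "\<dots> \<le> (SUP k. hausdorff_content s (e / 2 / Suc k) (A \<union> B))"
  proof (intro SUP_mono' hausdorff_content_separated)
    fix k show "0 \<le> e / 2 / Suc k" using e by simp
    fix a b assume "a \<in> A" "b \<in> B"
    then show "e / 2 / Suc k < dist a b" using sep lt[of k] by fastforce
  qed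
  also have "\<dots> = hausdorff_outer_measure s (A \<union> B)"
    using e by (simp add: hausdorff_outer_measure_eq_SUP[of "e / 2"])
  finally show ?thesis .
qed

lemma hausdorff_outer_measure_mono:
  "A \<subseteq> B \<Longrightarrow> hausdorff_outer_measure s A \<le> hausdorff_outer_measure s B"
  unfolding hausdorff_outer_measure_def by (intro SUP_mono' hausdorff_content_mono)

lemma hausdorff_outer_measure_empty [simp]: "hausdorff_outer_measure s {} = 0"
  using outer_measure_space_hausdorff[of s] by (auto simp: outer_measure_space_def positive_def)

lemma hausdorff_outer_measure_UN_le:
  "hausdorff_outer_measure s (\<Union>i::nat. A i) \<le> (\<Sum>i. hausdorff_outer_measure s (A i))"
proof (cases "disjoint_family A")
  case True
  then show ?thesis using outer_measure_space_hausdorff[of s, where 'a = 'a]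
    by (simp add: outer_measure_space_def countably_subadditive_def)
next
  case False
  have "hausdorff_outer_measure s (\<Union>i. A i) = hausdorff_outer_measure s (\<Union>i. disjointed A i)"
    by (simp add: UN_disjointed_eq)
  also have "\<dots> \<le> (\<Sum>i. hausdorff_outer_measure s (disjointed A i))"
    using outer_measure_space_hausdorff[of s, where 'a = 'a] disjoint_family_disjointed[of A]
    by (simp add: outer_measure_space_def countably_subadditive_def)
  also have "\<dots> \<le> (\<Sum>i. hausdorff_outer_measure s (A i))"
    by (intro suminf_le hausdorff_outer_measure_mono disjointed_subset) auto
  finally show ?thesis .
qed

lemma hausdorff_outer_measure_Un_le:
  "hausdorff_outer_measure s (A \<union> B) \<le> hausdorff_outer_measure s A + hausdorff_outer_measure s B"
proof -
  have eq: "A \<union> B = (\<Union>i. binaryset A B i)" by (simp add: UN_binaryset_eq)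
  have "(\<Sum>i. hausdorff_outer_measure s (binaryset A B i))
      = hausdorff_outer_measure s A + hausdorff_outer_measure s B"
    by (rule suminf_binaryset_eq) simp
  then show ?thesis using hausdorff_outer_measure_UN_le[of s "binaryset A B"] eq by simp
qed

text \<open>Caratheodory's argument for metric outer measures. The points of \<open>E - F\<close> at distance at
  least \<open>1 / Suc k\<close> from \<open>F\<close> are separated from \<open>F\<close>, so only the shells \<open>R j\<close> with \<open>j \<ge> k\<close>
  escape. Shells of equal parity are separated from each other, which makes the series of their
  measures converge, and the tail vanishes as \<open>k\<close> grows.\<close>

lemma closed_in_sets_hausdorff_measure:
  fixes F :: "'a::metric_space set"
  assumes "closed F"
  shows "F \<in> sets (hausdorff_measure s)"
proof (cases "F = {}")
  case False
  let ?H = "hausdorff_outer_measure s :: 'a set \<Rightarrow> ennreal"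
  have key: "?H (F \<inter> E) + ?H (E - F) \<le> ?H E" for E
  proof (cases "?H E = top")
    case fin: False
    define Ek where "Ek k = {x\<in>E. 1 / Suc k \<le> infdist x F}" for k :: nat
    define R where "R k = {x\<in>E. 1 / Suc (Suc k) \<le> infdist x F \<and> infdist x F < 1 / Suc k}" for k :: nat
    have sep: "?H (F \<inter> E) + ?H (Ek k) \<le> ?H E" for k
    proof -
      have "1 / Suc k \<le> dist a b" if "a \<in> F \<inter> E" "b \<in> Ek k" for a b
        using that infdist_le[of a F b] by (auto simp: Ek_def dist_commute)
      then have "?H (F \<inter> E) + ?H (Ek k) \<le> ?H (F \<inter> E \<union> Ek k)"
        by (intro hausdorff_outer_measure_separated[of "1 / Suc k"]) auto
      also have "\<dots> \<le> ?H E"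
        by (rule hausdorff_outer_measure_mono) (auto simp: Ek_def)
      finally show ?thesis .
    qed
    have alt: "(\<Sum>k. ?H (R (2 * k + b))) \<le> ?H E" for b
    proof (rule suminf_le_const)
      fix n
      have "(\<Sum>k<n. ?H (R (2 * k + b))) \<le> ?H (\<Union>k<n. R (2 * k + b))"
      proof (induction n)
        case (Suc n)
        define q :: real where "q = 1 / (2 * n + b) - 1 / (2 * n + b + 1)"
        have d: "q \<le> dist x y" and n: "n \<noteq> 0"
          if x: "x \<in> (\<Union>k<n. R (2 * k + b))" and y: "y \<in> R (2 * n + b)" for x y
        proof -
          obtain i where i: "i < n" "x \<in> R (2 * i + b)" using x by auto
          then show "n \<noteq> 0" by simp
          have "real (Suc (Suc (2 * i + b))) \<le> 2 * n + b" using i(1) by simp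
          then have "1 / (2 * n + b) \<le> 1 / real (Suc (Suc (2 * i + b)))"
            by (intro divide_left_mono) (use i in auto)
          also have "\<dots> \<le> infdist x F" using i by (auto simp: R_def)
          also have "\<dots> \<le> infdist y F + dist x y" by (rule infdist_triangle)
          also have "infdist y F < 1 / (2 * n + b + 1)" using y by (auto simp: R_def add_ac)
          finally show "q \<le> dist x y" by (simp add: q_def)
        qed
        have "?H (\<Union>k<n. R (2 * k + b)) + ?H (R (2 * n + b))
            \<le> ?H ((\<Union>k<n. R (2 * k + b)) \<union> R (2 * n + b))"
        proof (cases "n = 0")
          case True then show ?thesis by simp
        next
          case False
          then have "0 < q" by (simp add: q_def frac_less2)
          then show ?thesis using d by (rule hausdorff_outer_measure_separated)
        qed
        also have "(\<Union>k<n. R (2 * k + b)) \<union> R (2 * n + b) = (\<Union>k<Suc n. R (2 * k + b))"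
          by (auto simp: lessThan_Suc)
        finally have "?H (\<Union>k<n. R (2 * k + b)) + ?H (R (2 * n + b)) \<le> ?H (\<Union>k<Suc n. R (2 * k + b))" .
        moreover have "(\<Sum>k<Suc n. ?H (R (2 * k + b)))
            \<le> ?H (\<Union>k<n. R (2 * k + b)) + ?H (R (2 * n + b))"
          unfolding sum.lessThan_Suc using Suc.IH by (rule add_right_mono)
        ultimately show ?case by (rule order_trans[rotated])
      qed simp
      also have "\<dots> \<le> ?H E" by (rule hausdorff_outer_measure_mono) (auto simp: R_def)
      finally show "(\<Sum>k<n. ?H (R (2 * k + b))) \<le> ?H E" .
    qed simp
    define S where "S = (\<Sum>k. ?H (R k))"
    have "S = (\<Sum>k. ?H (R (2 * k + 0)) + ?H (R (2 * k + 1)))"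
    proof -
      have "(\<lambda>n. \<Sum>k<n. ?H (R k)) \<longlonglongrightarrow> S"
        unfolding S_def by (rule summable_LIMSEQ) simp
      then have "(\<lambda>n. \<Sum>k<2*n. ?H (R k)) \<longlonglongrightarrow> S"
        by (rule LIMSEQ_subseq_LIMSEQ[unfolded o_def, where f = "(*) 2"]) (auto simp: strict_mono_def)
      moreover have "(\<Sum>k<2*n. ?H (R k)) = (\<Sum>k<n. ?H (R (2 * k + 0)) + ?H (R (2 * k + 1)))" for n
        by (induction n) (auto simp: add_ac)
      ultimately have "(\<lambda>k. ?H (R (2 * k + 0)) + ?H (R (2 * k + 1))) sums S"
        by (simp add: sums_def)
      then show ?thesis by (rule sums_unique)
    qed
    also have "\<dots> = (\<Sum>k. ?H (R (2 * k + 0))) + (\<Sum>k. ?H (R (2 * k + 1)))"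
      by (rule suminf_add[symmetric]) auto
    also have "\<dots> \<le> ?H E + ?H E" by (intro add_mono alt)
    finally have S: "S \<noteq> top" using fin by (auto simp: top_unique)
    \<comment> \<open>Adding the first \<open>k\<close> shells to both sides turns the vanishing tail into a limit of partial
      sums, and the finite total \<open>S\<close> can be cancelled at the end.\<close>
    have part: "?H (F \<inter> E) + ?H (E - F) + (\<Sum>j<k. ?H (R j)) \<le> ?H E + S" for k
    proof -
      have "x \<in> Ek k \<union> (\<Union>j. R (j + k))" if x: "x \<in> E - F" for x
      proof (cases "1 / Suc k \<le> infdist x F")
        case False
        define P where "P j \<longleftrightarrow> 1 / Suc j \<le> infdist x F" for j :: nat
        have "infdist x F > 0"
          using x assms \<open>F \<noteq> {}\<close> by (simp add: infdist_pos_not_in_closed)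
        then obtain j0 :: nat where "1 / infdist x F < j0" using reals_Archimedean2 by blast
        then have "P j0" using \<open>infdist x F > 0\<close> by (simp add: P_def field_simps)
        define j where "j = (LEAST j. P j)"
        have j: "P j" unfolding j_def using \<open>P j0\<close> by (rule LeastI)
        have "k < j"
        proof (rule ccontr)
          assume "\<not> k < j"
          then have "1 / real (Suc k) \<le> 1 / Suc j" by (intro divide_left_mono) auto
          then show False using j False by (simp add: P_def)
        qed
        then obtain i where i: "j = Suc i" "k \<le> i" by (cases j) auto
        have "\<not> P i" using i not_less_Least[of i P] by (simp add: j_def)
        then have "x \<in> R (i - k + k)" using i j x by (auto simp: R_def P_def)
        then show ?thesis by blast
      qed (use x in \<open>auto simp: Ek_def\<close>)
      then have "?H (E - F) \<le> ?H (Ek k \<union> (\<Union>j. R (j + k)))"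
        by (intro hausdorff_outer_measure_mono) auto
      also have "\<dots> \<le> ?H (Ek k) + ?H (\<Union>j. R (j + k))" by (rule hausdorff_outer_measure_Un_le)
      also have "\<dots> \<le> ?H (Ek k) + (\<Sum>j. ?H (R (j + k)))"
        by (intro add_left_mono hausdorff_outer_measure_UN_le)
      finally have "?H (F \<inter> E) + ?H (E - F) + (\<Sum>j<k. ?H (R j))
          \<le> ?H (F \<inter> E) + (?H (Ek k) + (\<Sum>j. ?H (R (j + k)))) + (\<Sum>j<k. ?H (R j))"
        by (intro add_mono) auto
      also have "\<dots> = (?H (F \<inter> E) + ?H (Ek k)) + ((\<Sum>j. ?H (R (j + k))) + (\<Sum>j<k. ?H (R j)))"
        by (simp add: add_ac)
      also have "(\<Sum>j. ?H (R (j + k))) + (\<Sum>j<k. ?H (R j)) = S"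
        unfolding S_def using suminf_offset[of "\<lambda>j. ?H (R j)" k] by (simp add: add_ac)
      finally show ?thesis using sep[of k] by (meson add_right_mono order_trans)
    qed
    have "(\<lambda>k. ?H (F \<inter> E) + ?H (E - F) + (\<Sum>j<k. ?H (R j))) \<longlonglongrightarrow> ?H (F \<inter> E) + ?H (E - F) + S"
      unfolding S_def by (intro tendsto_add tendsto_const summable_LIMSEQ) simp
    then have "?H (F \<inter> E) + ?H (E - F) + S \<le> ?H E + S"
      by (rule LIMSEQ_le_const2) (use part in auto)
    then show ?thesis using S by (simp add: ennreal_add_left_cancel_le add.commute[of _ S])
  qed simp
  have "?H (F \<inter> E) + ?H (E - F) = ?H E" for E
  proof (rule antisym[OF key])
    have "E = F \<inter> E \<union> (E - F)" by blast
    then show "?H E \<le> ?H (F \<inter> E) + ?H (E - F)"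
      using hausdorff_outer_measure_Un_le[of s "F \<inter> E" "E - F"] by simp
  qed
  moreover have "(UNIV - F) \<inter> E = E - F" for E by blast
  ultimately show ?thesis by (simp add: sets_hausdorff_measure lambda_system_def)
qed simp

lemma borel_subset_sets_hausdorff_measure:
  "sets borel \<subseteq> sets (hausdorff_measure s :: 'a::metric_space measure)"
  unfolding borel_eq_closed
  by (subst sets_measure_of) (auto intro!: sets.sigma_sets_subset[where M = "hausdorff_measure s", simplified]
      dest: closed_in_sets_hausdorff_measure)

lemma diameter_isometry:
  assumes "\<And>x y. dist (T x) (T y) = dist x y"
  shows "diameter (T ` S) = diameter S"
proof -
  have "(\<lambda>(x, y). dist x y) ` (T ` S \<times> T ` S) = (\<lambda>(x, y). dist x y) ` (S \<times> S)"
    using assms by (force simp: image_iff)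
  then show ?thesis by (simp add: diameter_def)
qed

lemma hausdorff_outer_measure_isometry_le:
  fixes T :: "'a::metric_space \<Rightarrow> 'b::metric_space"
  assumes iso: "\<And>x y. dist (T x) (T y) = dist x y"
  shows "hausdorff_outer_measure s (T ` A) \<le> hausdorff_outer_measure s A"
proof -
  have "hausdorff_content s d (T ` A) \<le> hausdorff_content s d A" for d
    unfolding hausdorff_content_def[of s d A]
  proof (rule INF_greatest)
    fix C :: "nat \<Rightarrow> 'a set"
    assume C: "C \<in> {C. A \<subseteq> (\<Union>i. C i) \<and> (\<forall>i. bounded (C i) \<and> diameter (C i) \<le> d)}"
    have "bounded (T ` C i)" for i
    proof -
      have "bounded (C i)" using C by blast
      then obtain x e where "\<forall>y\<in>C i. dist x y \<le> e" by (auto simp: bounded_def)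
      then have "\<forall>y\<in>T ` C i. dist (T x) y \<le> e" by (simp add: iso)
      then show ?thesis unfolding bounded_def by blast
    qed
    then have "hausdorff_content s d (T ` A) \<le> (\<Sum>i. hausdorff_weight s (T ` C i))"
      unfolding hausdorff_content_def
      using C by (intro INF_lower CollectI conjI allI) (auto simp: diameter_isometry[OF iso] image_UN[symmetric] simp del: UN_simps)
    moreover have "hausdorff_weight s (T ` C i) = hausdorff_weight s (C i)" for i
      by (simp add: hausdorff_weight_def diameter_isometry[OF iso])
    ultimately show "hausdorff_content s d (T ` A) \<le> (\<Sum>i. hausdorff_weight s (C i))" by simp
  qed
  then show ?thesis unfolding hausdorff_outer_measure_def by (intro SUP_mono')
qed

lemma hausdorff_outer_measure_isometry:
  fixes T :: "'a::metric_space \<Rightarrow> 'b::metric_space"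
  assumes iso: "\<And>x y. dist (T x) (T y) = dist x y" and "surj T"
  shows "hausdorff_outer_measure s (T ` A) = hausdorff_outer_measure s A"
proof (rule antisym)
  have inj: "inj T" using iso by (metis dist_eq_0_iff injI)
  have "dist (inv T x) (inv T y) = dist x y" for x y
    using iso[of "inv T x" "inv T y"] \<open>surj T\<close> by (simp add: surj_f_inv_f)
  then have "hausdorff_outer_measure s (inv T ` (T ` A)) \<le> hausdorff_outer_measure s (T ` A)"
    by (rule hausdorff_outer_measure_isometry_le)
  then show "hausdorff_outer_measure s A \<le> hausdorff_outer_measure s (T ` A)"
    using inj by (simp add: image_comp)
qed (rule hausdorff_outer_measure_isometry_le[OF iso])

lemma measurable_isometry_hausdorff_measure:
  fixes T :: "'a::metric_space \<Rightarrow> 'b::metric_space"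
  assumes iso: "\<And>x y. dist (T x) (T y) = dist x y" and "surj T"
  shows "T \<in> measurable (hausdorff_measure s) (hausdorff_measure s)"
proof (rule measurableI)
  fix A :: "'b set" assume A: "A \<in> sets (hausdorff_measure s)"
  let ?H = "\<lambda>A. hausdorff_outer_measure s A"
  have "?H (T -` A \<inter> E) + ?H ((UNIV - T -` A) \<inter> E) = ?H E" for E :: "'a set"
  proof -
    have inj: "inj T" using iso by (metis dist_eq_0_iff injI)
    have "T ` (T -` A \<inter> E) = A \<inter> T ` E" "T ` ((UNIV - T -` A) \<inter> E) = (UNIV - A) \<inter> T ` E"
      by auto
    moreover have "?H (A \<inter> T ` E) + ?H ((UNIV - A) \<inter> T ` E) = ?H (T ` E)"
      using A by (auto simp: sets_hausdorff_measure lambda_system_def)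
    ultimately show ?thesis
      using hausdorff_outer_measure_isometry[OF assms, of s] by metis
  qed
  then show "T -` A \<inter> space (hausdorff_measure s) \<in> sets (hausdorff_measure s)"
    by (simp add: sets_hausdorff_measure lambda_system_def)
qed simp

lemma distr_hausdorff_measure_isometry:
  fixes T :: "'a::metric_space \<Rightarrow> 'b::metric_space"
  assumes "\<And>x y. dist (T x) (T y) = dist x y" and "surj T"
  shows "distr (hausdorff_measure s) (hausdorff_measure s) T = hausdorff_measure s"
proof (rule measure_eqI)
  fix A assume "A \<in> sets (distr (hausdorff_measure s) (hausdorff_measure s) T)"
  then have A: "A \<in> sets (hausdorff_measure s)" by simp
  note T = measurable_isometry_hausdorff_measure[OF assms, of s]
  have "T -` A \<in> sets (hausdorff_measure s)" using measurable_sets[OF T A] by simp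
  then have "emeasure (distr (hausdorff_measure s) (hausdorff_measure s) T) A
      = hausdorff_outer_measure s (T -` A)"
    using T A by (simp add: emeasure_distr emeasure_hausdorff_measure)
  also have "\<dots> = hausdorff_outer_measure s (T ` (T -` A))"
    by (rule hausdorff_outer_measure_isometry[OF assms, symmetric])
  also have "\<dots> = emeasure (hausdorff_measure s) A"
    using A \<open>surj T\<close> by (simp add: emeasure_hausdorff_measure surj_image_vimage_eq)
  finally show "emeasure (distr (hausdorff_measure s) (hausdorff_measure s) T) A
      = emeasure (hausdorff_measure s) A" .
qed simp

section \<open>Translation invariant measures\<close>

text \<open>Uniqueness of Haar measure by Fubini: both sides are the double integral of
  \<open>indicator B x * indicator A (x + y)\<close> over \<open>M \<Otimes>\<^sub>M lborel\<close>. Integrating over \<open>y\<close> first gives the left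
  side; shifting \<open>x\<close> by \<open>y\<close> before integrating over \<open>y\<close> gives the right side, because Lebesgue
  measure is also invariant under reflection.\<close>

lemma translation_invariant_emeasure_swap:
  fixes M :: "'a::euclidean_space measure"
  assumes sM[measurable_cong]: "sets M = sets borel" and sf: "sigma_finite_measure M"
    and inv: "\<And>v. distr M borel ((+) v) = M"
    and [measurable]: "A \<in> sets borel" "B \<in> sets borel"
  shows "emeasure M B * emeasure lborel A = emeasure M A * emeasure lborel B"
proof -
  interpret sigma_finite_measure M by fact
  interpret pair_sigma_finite M lborel ..
  have shiftM: "(\<integral>\<^sup>+ x. h (y + x) \<partial>M) = (\<integral>\<^sup>+ x. h x \<partial>M)" if [measurable]: "h \<in> borel_measurable borel"
    for h :: "'a \<Rightarrow> ennreal" and y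
    by (subst (2) inv[of y, symmetric]) (simp add: nn_integral_distr)
  have shiftL: "(\<integral>\<^sup>+ x. h (y + x) \<partial>lborel) = (\<integral>\<^sup>+ x. h x \<partial>lborel)" if [measurable]: "h \<in> borel_measurable borel"
    for h :: "'a \<Rightarrow> ennreal" and y
    by (subst (2) lborel_distr_plus[of y, symmetric]) (simp add: nn_integral_distr)
  have reflL: "(\<integral>\<^sup>+ x. h (y - x) \<partial>lborel) = (\<integral>\<^sup>+ x. h x \<partial>lborel)" if [measurable]: "h \<in> borel_measurable borel"
    for h :: "'a \<Rightarrow> ennreal" and y
    by (subst (2) lborel_affine[of "-1" y]) (simp_all add: density_1 nn_integral_distr)
  have "emeasure M B * emeasure lborel A = (\<integral>\<^sup>+ x. indicator B x * (\<integral>\<^sup>+ y. indicator A (x + y) \<partial>lborel) \<partial>M)"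
    by (simp add: shiftL nn_integral_multc)
  also have "\<dots> = (\<integral>\<^sup>+ x. (\<integral>\<^sup>+ y. indicator B x * indicator A (x + y) \<partial>lborel) \<partial>M)"
    by (simp add: nn_integral_cmult)
  also have "\<dots> = (\<integral>\<^sup>+ y. (\<integral>\<^sup>+ x. indicator B x * indicator A (x + y) \<partial>M) \<partial>lborel)"
    using Fubini'[of "\<lambda>x y. indicator B x * indicator A (x + y)"] by simp
  also have "\<dots> = (\<integral>\<^sup>+ y. (\<integral>\<^sup>+ x. indicator B (x - y) * indicator A x \<partial>M) \<partial>lborel)"
  proof (rule nn_integral_cong)
    fix y show "(\<integral>\<^sup>+ x. indicator B x * indicator A (x + y) \<partial>M) = (\<integral>\<^sup>+ x. indicator B (x - y) * indicator A x \<partial>M)"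
      using shiftM[of "\<lambda>x. indicator B (x - y) * indicator A x" y] by (simp add: add.commute)
  qed
  also have "\<dots> = (\<integral>\<^sup>+ x. (\<integral>\<^sup>+ y. indicator B (x - y) * indicator A x \<partial>lborel) \<partial>M)"
    using Fubini'[of "\<lambda>x y. indicator B (x - y) * indicator A x"] by simp
  also have "\<dots> = (\<integral>\<^sup>+ x. emeasure lborel B * indicator A x \<partial>M)"
    by (simp add: nn_integral_multc reflL)
  also have "\<dots> = emeasure M A * emeasure lborel B"
    by (subst nn_integral_cmult_indicator) (auto simp: mult.commute)
  finally show ?thesis .
qed

lemma translation_invariant_eq_lborel:
  fixes M :: "'a::euclidean_space measure"
  assumes "sets M = sets borel" "sigma_finite_measure M" "\<And>v. distr M borel ((+) v) = M"
    and "U \<in> sets borel" "emeasure lborel U = 1"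
  shows "M = density lborel (\<lambda>_. emeasure M U)"
proof (rule measure_eqI)
  fix A assume "A \<in> sets M"
  then show "emeasure M A = emeasure (density lborel (\<lambda>_. emeasure M U)) A"
    using translation_invariant_emeasure_swap[OF assms(1-3), of A U] assms
    by (simp add: emeasure_density_const)
qed (simp add: assms)

text \<open>The facet of the cube with least corner \<open>p\<close> and side \<open>r\<close> that is orthogonal to axis \<open>k\<close>.\<close>

definition cube_face :: "'n \<Rightarrow> real ^ 'n \<Rightarrow> real \<Rightarrow> (real ^ 'n) set" where
  "cube_face k p r = {x. x $ k = p $ k \<and> (\<forall>i. i \<noteq> k \<longrightarrow> p $ i \<le> x $ i \<and> x $ i \<le> p $ i + r)}"

section \<open>The Hausdorff measure of the facets of a cube\<close>

lemma emeasure_lborel_cbox_cart: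
  fixes a b :: "real ^ 'n"
  assumes "\<And>i. a $ i \<le> b $ i"
  shows "emeasure lborel (cbox a b) = ennreal (\<Prod>i\<in>UNIV. b $ i - a $ i)"
proof -
  have "cbox a b \<noteq> {}" using assms by (simp add: interval_ne_empty_cart)
  then have "measure lborel (cbox a b) = (\<Prod>i\<in>UNIV. b $ i - a $ i)" by (rule content_cbox_cart)
  moreover have "emeasure lborel (cbox a b) = ennreal (measure lborel (cbox a b))"
    by (intro emeasure_eq_ennreal_measure) (simp add: emeasure_lborel_cbox_eq)
  ultimately show ?thesis by simp
qed

text \<open>Thickening by \<open>r\<close> in direction \<open>k\<close> turns a cover of the facet into a cover of a cube of
  side \<open>r\<close>. A set of diameter \<open>d\<close> thickens to a subset of a box of volume \<open>r * (2 * d) ^ (n - 1)\<close>,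
  which is a fixed multiple of its Hausdorff weight; so the volume of the cube bounds the sum of the
  weights from below.\<close>

lemma hausdorff_outer_measure_cube_face_pos:
  fixes p :: "real ^ 'n"
  assumes r: "0 < r"
  shows "0 < hausdorff_outer_measure (CARD('n) - 1) (cube_face k p r)"
proof -
  define m where "m = CARD('n) - 1"
  define K where "K = r * 4 ^ m / unit_ball_vol (real m)"
  have K: "0 < K" using r by (simp add: K_def)
  let ?cube = "cbox p (\<chi> i. p $ i + r)"
  have prod_k: "(\<Prod>i\<in>UNIV. if i = k then a else b) = a * b ^ m" for a b :: real
    by (simp add: prod.If_cases m_def Compl_eq_Diff_UNIV)
  have "emeasure lborel ?cube = ennreal (r ^ CARD('n))"
    using r by (subst emeasure_lborel_cbox_cart) auto
  have "ennreal (1 / K) * emeasure lborel ?cube \<le> hausdorff_content m 1 (cube_face k p r)"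
    unfolding hausdorff_content_def
  proof (rule INF_greatest)
    fix C :: "nat \<Rightarrow> (real ^ 'n) set"
    assume "C \<in> {C. cube_face k p r \<subseteq> (\<Union>i. C i) \<and> (\<forall>i. bounded (C i) \<and> diameter (C i) \<le> 1)}"
    then have cov: "cube_face k p r \<subseteq> (\<Union>i. C i)" and bd: "\<And>i. bounded (C i)" by auto
    define a where "a i = (SOME x. x \<in> C i)" for i
    define d where "d i = diameter (C i)" for i
    have d0: "0 \<le> d i" for i using bd by (simp add: d_def diameter_ge_0)
    define Q where "Q i = (if C i = {} then {} else
      cbox (\<chi> j. if j = k then p $ k else a i $ j - d i) (\<chi> j. if j = k then p $ k + r else a i $ j + d i))" for i
    have cov': "?cube \<subseteq> (\<Union>i. Q i)"
    proof
      fix x assume x: "x \<in> ?cube"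
      define x' where "x' = (\<chi> j. if j = k then p $ k else x $ j)"
      have "x' \<in> cube_face k p r" using x by (auto simp: cube_face_def x'_def mem_box_cart)
      then obtain i where i: "x' \<in> C i" using cov by blast
      then have ai: "a i \<in> C i" unfolding a_def by (rule someI)
      have "\<bar>x' $ j - a i $ j\<bar> \<le> d i" for j
      proof -
        have "\<bar>x' $ j - a i $ j\<bar> \<le> dist x' (a i)"
          using component_le_norm_cart[of "x' - a i" j] by (simp add: dist_norm)
        also have "\<dots> \<le> d i" unfolding d_def by (rule diameter_bounded_bound[OF bd i ai])
        finally show ?thesis .
      qed
      then have "\<bar>x $ j - a i $ j\<bar> \<le> d i" if "j \<noteq> k" for j
        using that by (simp add: x'_def) (metis that)
      then have "x \<in> Q i" using i x by (auto simp: Q_def mem_box_cart abs_le_iff algebra_simps)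
      then show "x \<in> (\<Union>i. Q i)" by blast
    qed
    have Q: "ennreal (1 / K) * emeasure lborel (Q i) = hausdorff_weight m (C i)" for i
    proof (cases "C i = {}")
      case False
      have "emeasure lborel (Q i) = ennreal (r * (2 * d i) ^ m)"
        using False r d0[of i] prod_k[of r "2 * d i"]
        by (simp add: Q_def emeasure_lborel_cbox_cart if_distrib if_distribR cong: if_cong)
      then have "ennreal (1 / K) * emeasure lborel (Q i) = ennreal (1 / K * (r * (2 * d i) ^ m))"
        using K by (simp only: ennreal_mult' less_imp_le zero_le_divide_1_iff)
      also have "1 / K * (r * (2 * d i) ^ m) = unit_ball_vol (real m) * (d i / 2) ^ m"
      proof -
        have "(2 * d i) ^ m = (4 * (d i / 2)) ^ m" by simp
        also have "\<dots> = 4 ^ m * (d i / 2) ^ m" by (rule power_mult_distrib)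
        finally have "(2 * d i) ^ m = 4 ^ m * (d i / 2) ^ m" .
        then show ?thesis using r by (simp add: K_def)
      qed
      also have "ennreal (unit_ball_vol (real m) * (d i / 2) ^ m) = hausdorff_weight m (C i)"
        using False by (simp add: hausdorff_weight_def d_def)
      finally show ?thesis .
    qed (simp add: Q_def)
    have "ennreal (1 / K) * emeasure lborel ?cube \<le> ennreal (1 / K) * emeasure lborel (\<Union>i. Q i)"
      by (intro mult_left_mono emeasure_mono cov') (auto simp: Q_def)
    also have "\<dots> \<le> ennreal (1 / K) * (\<Sum>i. emeasure lborel (Q i))"
      by (intro mult_left_mono emeasure_subadditive_countably) (auto simp: Q_def)
    also have "\<dots> = (\<Sum>i. hausdorff_weight m (C i))"
      by (simp add: Q flip: ennreal_suminf_cmult)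
    finally show "ennreal (1 / K) * emeasure lborel ?cube \<le> (\<Sum>i. hausdorff_weight m (C i))" .
  qed
  also have "\<dots> \<le> hausdorff_outer_measure m (cube_face k p r)"
    unfolding hausdorff_outer_measure_def by (intro SUP_upper) simp
  finally have "ennreal (1 / K) * emeasure lborel ?cube \<le> hausdorff_outer_measure m (cube_face k p r)" .
  moreover have "0 < ennreal (1 / K) * emeasure lborel ?cube"
    using K r by (simp add: \<open>emeasure lborel ?cube = _\<close> ennreal_zero_less_mult_iff)
  ultimately show ?thesis by (simp add: m_def)
qed

lemma hausdorff_content_finite_cover:
  assumes "finite I" and cov: "A \<subseteq> (\<Union>i\<in>I. Q i)"
    and Q: "\<And>i. i \<in> I \<Longrightarrow> bounded (Q i) \<and> diameter (Q i) \<le> d" and d: "0 \<le> d"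
  shows "hausdorff_content s d A \<le> ennreal (card I * (unit_ball_vol (real s) * (d / 2) ^ s))"
proof -
  obtain h where h: "bij_betw h {0..<card I} I" using ex_bij_betw_nat_finite[OF \<open>finite I\<close>] by blast
  define C where "C i = (if i < card I then Q (h i) else {})" for i
  have hI: "h i \<in> I" if "i < card I" for i using h that by (auto simp: bij_betw_def)
  have "A \<subseteq> (\<Union>i. C i)"
  proof
    fix x assume "x \<in> A"
    then obtain j where j: "j \<in> I" "x \<in> Q j" using cov by blast
    moreover have "h ` {0..<card I} = I" using h by (simp add: bij_betw_def)
    ultimately obtain i where "i < card I" "j = h i" by fastforce
    then have "x \<in> C i" using j by (simp add: C_def)
    then show "x \<in> (\<Union>i. C i)" by blast
  qed
  then have "hausdorff_content s d A \<le> (\<Sum>i. hausdorff_weight s (C i))"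
    unfolding hausdorff_content_def using Q hI d by (intro INF_lower) (auto simp: C_def)
  also have "\<dots> = (\<Sum>i<card I. hausdorff_weight s (C i))"
    by (rule suminf_finite) (auto simp: C_def)
  also have "\<dots> \<le> (\<Sum>i<card I. ennreal (unit_ball_vol (real s) * (d / 2) ^ s))"
  proof (rule sum_mono)
    fix i assume "i \<in> {..<card I}"
    then have "bounded (C i)" "diameter (C i) \<le> d" using Q hI by (auto simp: C_def)
    then show "hausdorff_weight s (C i) \<le> ennreal (unit_ball_vol (real s) * (d / 2) ^ s)"
      by (auto simp: hausdorff_weight_def diameter_ge_0 intro!: ennreal_leI mult_left_mono power_mono)
  qed
  also have "\<dots> = ennreal (card I * (unit_ball_vol (real s) * (d / 2) ^ s))"
    by (simp add: ennreal_mult' ennreal_of_nat_eq_real_of_nat)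
  finally show ?thesis .
qed

text \<open>Cutting the facet into \<open>M ^ (n - 1)\<close> equal cells of side \<open>r / M\<close> gives a sum of weights
  that does not depend on \<open>M\<close>.\<close>

lemma hausdorff_outer_measure_cube_face_finite:
  fixes p :: "real ^ 'n"
  assumes r: "0 < r"
  shows "hausdorff_outer_measure (CARD('n) - 1) (cube_face k p r) < \<infinity>"
proof -
  define m where "m = CARD('n) - 1"
  define N where "N = CARD('n)"
  let ?b = "unit_ball_vol (real m) * (N * r / 2) ^ m"
  have "hausdorff_content m d (cube_face k p r) \<le> ennreal ?b" if d: "0 < d" for d
  proof -
    obtain M :: nat where M: "N * r / d < M" using reals_Archimedean2 by blast
    moreover have "0 \<le> N * r / d" using r d by simp
    ultimately have M0: "0 < real M" by linarith
    have dM: "N * r / M \<le> d" using M M0 d by (simp add: field_simps)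
    define I where "I = (\<Pi>\<^sub>E j\<in>(UNIV :: 'n set). if j = k then {0::nat} else {..<M})"
    have "finite I" unfolding I_def by (intro finite_PiE) auto
    have "card I = (\<Prod>j\<in>(UNIV :: 'n set). if j = k then 1 else M)"
      unfolding I_def by (subst card_PiE) (auto intro!: prod.cong)
    then have cardI: "card I = M ^ m"
      by (simp add: prod.If_cases m_def Compl_eq_Diff_UNIV)
    define Q where "Q f = {x :: real ^ 'n. x $ k = p $ k \<and>
        (\<forall>j. j \<noteq> k \<longrightarrow> p $ j + r * f j / M \<le> x $ j \<and> x $ j \<le> p $ j + r * (f j + 1) / M)}" for f :: "'n \<Rightarrow> nat"
    have Qd: "dist x y \<le> N * r / M" if "x \<in> Q f" "y \<in> Q f" for x y f
    proof -
      have "\<bar>(x - y) $ j\<bar> \<le> r / M" for j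
      proof (cases "j = k")
        case False
        then have "p $ j + r * f j / M \<le> x $ j" "x $ j \<le> p $ j + r * f j / M + r / M"
          "p $ j + r * f j / M \<le> y $ j" "y $ j \<le> p $ j + r * f j / M + r / M"
          using that by (auto simp: Q_def ring_distribs add_divide_distrib)
        then show ?thesis by (simp add: abs_le_iff)
      qed (use that r in \<open>auto simp: Q_def\<close>)
      then have "(\<Sum>j\<in>UNIV. \<bar>(x - y) $ j\<bar>) \<le> (\<Sum>j\<in>(UNIV::'n set). r / M)" by (intro sum_mono)
      then show ?thesis using norm_le_l1_cart[of "x - y"] by (simp add: dist_norm N_def)
    qed
    have "bounded (Q f)" for f unfolding bounded_two_points using Qd by blast
    moreover have "diameter (Q f) \<le> N * r / M" for f
      using Qd r by (intro diameter_le) (auto simp: dist_norm)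
    moreover have "cube_face k p r \<subseteq> (\<Union>f\<in>I. Q f)"
    proof
      fix x assume x: "x \<in> cube_face k p r"
      define f where "f j = (if j = k then 0 else min (M - 1) (nat \<lfloor>(x $ j - p $ j) * M / r\<rfloor>))" for j
      have "f \<in> I" using M0 by (auto simp: I_def f_def)
      moreover have "p $ j + r * f j / M \<le> x $ j \<and> x $ j \<le> p $ j + r * (f j + 1) / M" if "j \<noteq> k" for j
      proof -
        define u where "u = (x $ j - p $ j) * M / r"
        have "0 \<le> x $ j - p $ j" "x $ j - p $ j \<le> r" using x that by (auto simp: cube_face_def)
        then have "0 \<le> (x $ j - p $ j) * M" "(x $ j - p $ j) * M \<le> r * M"
          using M0 by (simp_all add: mult_right_mono)
        then have u: "0 \<le> u" "u \<le> M" using r by (auto simp: u_def divide_le_eq mult.commute)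
        have xj: "x $ j = p $ j + r * u / M" using r M0 by (simp add: u_def)
        \<comment> \<open>The minimum with \<open>M - 1\<close> puts the far boundary \<open>u = M\<close> into the last cell.\<close>
        have "f j \<le> u" using u that by (auto simp: f_def u_def[symmetric] min_def le_nat_iff) linarith
        moreover have "u \<le> f j + 1"
        proof (cases "M - 1 \<le> nat \<lfloor>u\<rfloor>")
          case True
          then have "f j = M - 1" using that by (simp add: f_def u_def[symmetric])
          then show ?thesis using u M0 by simp
        next
          case False
          then have "f j = nat \<lfloor>u\<rfloor>" using that by (simp add: f_def u_def[symmetric])
          then show ?thesis using u by linarith
        qed
        ultimately show ?thesis unfolding xj using r M0
          by (auto intro!: divide_right_mono mult_left_mono)
      qed
      ultimately show "x \<in> (\<Union>f\<in>I. Q f)" using x by (auto simp: Q_def cube_face_def)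
    qed
    ultimately have "hausdorff_content m (N * r / M) (cube_face k p r)
        \<le> ennreal (card I * (unit_ball_vol (real m) * (N * r / M / 2) ^ m))"
      using r by (intro hausdorff_content_finite_cover[OF \<open>finite I\<close>, of _ Q]) auto
    also have "card I * (unit_ball_vol (real m) * (N * r / M / 2) ^ m) = ?b"
      using M0 by (simp add: cardI power_divide power_mult_distrib)
    finally show ?thesis using hausdorff_content_antimono[OF dM] by (rule order_trans[rotated])
  qed
  then have "hausdorff_outer_measure m (cube_face k p r) \<le> ennreal ?b"
    unfolding hausdorff_outer_measure_def by (intro SUP_least) auto
  also have "\<dots> < \<infinity>" by simp
  finally show ?thesis by (simp add: m_def)
qed

section \<open>Stacking the slices along a coordinate axis\<close>

lemma borel_in_sets_hausdorff_measure: "A \<in> sets borel \<Longrightarrow> A \<in> sets (hausdorff_measure s)"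
  using borel_subset_sets_hausdorff_measure by blast

lemma borel_measurable_hausdorff_measure:
  "f \<in> borel_measurable borel \<Longrightarrow> f \<in> borel_measurable (hausdorff_measure s)"
  by (auto intro!: measurableI borel_in_sets_hausdorff_measure dest: measurable_sets)

abbreviation surface_measure :: "(real ^ 'n) measure" where
  "surface_measure \<equiv> hausdorff_measure (CARD('n) - 1)"

text \<open>The area measure of the hyperplane \<open>x $ k = t\<close>, as a Borel measure on the whole space: there
  it can be translated, projected along \<open>k\<close>, and used as a factor of a product measure.\<close>

definition slice_measure :: "'n \<Rightarrow> real \<Rightarrow> (real ^ 'n) measure" where
  "slice_measure k t = distr (density surface_measure (indicator {x. x $ k = t})) borel (\<lambda>x. x)"

lemma sets_slice_measure [simp, measurable_cong]: "sets (slice_measure k t) = sets borel"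
  by (simp add: slice_measure_def)

lemma space_slice_measure [simp]: "space (slice_measure k t) = UNIV"
  by (simp add: slice_measure_def)

lemma id_measurable_slice:
  "(\<lambda>x :: real ^ 'n. x) \<in> measurable (density surface_measure (indicator {x. x $ k = t})) borel"
  by (rule measurableI) (auto intro: borel_in_sets_hausdorff_measure)

lemma indicator_plane_measurable:
  "(indicator {x :: real ^ 'n. x $ k = t} :: _ \<Rightarrow> 'b::{zero_neq_one,topological_space,semiring_1}) \<in> borel_measurable (hausdorff_measure s)"
  by (intro borel_measurable_indicator borel_in_sets_hausdorff_measure) simp

lemma emeasure_slice_measure:
  fixes A :: "(real ^ 'n) set"
  assumes A: "A \<in> sets borel"
  shows "emeasure (slice_measure k t) A = hausdorff_outer_measure (CARD('n) - 1) (A \<inter> {x. x $ k = t})"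
proof -
  have B: "A \<inter> {x. x $ k = t} \<in> sets surface_measure"
    using A by (intro borel_in_sets_hausdorff_measure) simp
  have "emeasure (slice_measure k t) A = emeasure (density surface_measure (indicator {x. x $ k = t})) A"
    unfolding slice_measure_def using A by (subst emeasure_distr[OF id_measurable_slice]) auto
  also have "\<dots> = (\<integral>\<^sup>+ x. indicator (A \<inter> {x. x $ k = t}) x \<partial>surface_measure)"
    using A by (subst emeasure_density)
      (auto intro!: nn_integral_cong indicator_plane_measurable borel_in_sets_hausdorff_measure split: split_indicator)
  also have "\<dots> = hausdorff_outer_measure (CARD('n) - 1) (A \<inter> {x. x $ k = t})"
    using B by (simp add: emeasure_hausdorff_measure)
  finally show ?thesis .
qed

lemma integral_slice_measure:
  fixes F :: "real ^ 'n \<Rightarrow> real"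
  assumes F: "F \<in> borel_measurable borel"
  shows "(LINT x|slice_measure k t. F x) = (LINT x|surface_measure. indicator {x. x $ k = t} x * F x)"
proof -
  have "(LINT x|slice_measure k t. F x)
      = (LINT x|density surface_measure (\<lambda>x. ennreal (indicator {x. x $ k = t} x)). F x)"
    unfolding slice_measure_def using F id_measurable_slice[of k t]
    by (subst integral_distr) (simp_all add: ennreal_indicator)
  also have "\<dots> = (LINT x|surface_measure. indicator {x. x $ k = t} x *\<^sub>R F x)"
    by (rule integral_density) (auto intro!: borel_measurable_hausdorff_measure F)
  finally show ?thesis by simp
qed

lemma AE_slice_measureD:
  assumes "AE x in slice_measure k t. P x"
  shows "AE x in surface_measure. x $ k = t \<longrightarrow> P x"
proof -
  have "AE x in density surface_measure (indicator {x. x $ k = t}). P x"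
    using assms unfolding slice_measure_def by (rule AE_distrD[OF id_measurable_slice])
  then show ?thesis
    by (subst (asm) AE_density) (auto simp: indicator_plane_measurable elim: eventually_mono)
qed

text \<open>Projection along axis \<open>k\<close> onto the hyperplane \<open>x $ k = t\<close>.\<close>

definition slice_lift :: "'n \<Rightarrow> real \<Rightarrow> real ^ 'n \<Rightarrow> real ^ 'n" where
  "slice_lift k t x = x + (t - x $ k) *\<^sub>R axis k 1"

lemma slice_lift_nth: "slice_lift k t x $ i = (if i = k then t else x $ i)"
  by (simp add: slice_lift_def axis_def)

lemma vec_nth_borel_measurable [measurable]: "(\<lambda>x :: real ^ 'n. x $ k) \<in> borel_measurable borel"
  by (intro borel_measurable_continuous_onI continuous_intros)

lemma slice_lift_measurable [measurable]: "(\<lambda>(t, x). slice_lift k t x) \<in> borel_measurable (borel \<Otimes>\<^sub>M borel)"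
  unfolding slice_lift_def by measurable

lemma slice_lift_measurable1 [measurable]: "slice_lift k t \<in> borel_measurable borel"
  unfolding slice_lift_def by measurable

lemma distr_slice_measure_lift: "distr (slice_measure k u) borel (slice_lift k t) = slice_measure k t"
proof (rule measure_eqI)
  fix A assume "A \<in> sets (distr (slice_measure k u) borel (slice_lift k t))"
  then have A[measurable]: "A \<in> sets borel" by simp
  let ?T = "\<lambda>x. x + (t - u) *\<^sub>R axis k 1"
  have "?T ` (slice_lift k t -` A \<inter> {x. x $ k = u}) = A \<inter> {x. x $ k = t}"
  proof (intro equalityI subsetI)
    fix y assume y: "y \<in> A \<inter> {x. x $ k = t}"
    have "y - (t - u) *\<^sub>R axis k 1 \<in> slice_lift k t -` A \<inter> {x. x $ k = u}"
      using y by (auto simp: slice_lift_def)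
    then show "y \<in> ?T ` (slice_lift k t -` A \<inter> {x. x $ k = u})"
      by (rule rev_image_eqI) simp
  qed (auto simp: slice_lift_def)
  moreover have "slice_lift k t -` A \<in> sets borel"
    using measurable_sets[OF slice_lift_measurable1 A, of k t] by simp
  moreover have "surj ?T" by (rule surjI[of _ "\<lambda>x. x - (t - u) *\<^sub>R axis k 1"]) simp
  ultimately show "emeasure (distr (slice_measure k u) borel (slice_lift k t)) A = emeasure (slice_measure k t) A"
    using hausdorff_outer_measure_isometry[of ?T _ "slice_lift k t -` A \<inter> {x. x $ k = u}"]
    by (simp add: emeasure_distr emeasure_slice_measure)
qed simp

lemma distr_slice_measure_translate:
  assumes v: "v $ k = 0"
  shows "distr (slice_measure k t) borel ((+) v) = slice_measure k t"
proof (rule measure_eqI)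
  fix A assume "A \<in> sets (distr (slice_measure k t) borel ((+) v))"
  then have A[measurable]: "A \<in> sets borel" by simp
  have "(+) v ` ((+) v -` A \<inter> {x. x $ k = t}) = A \<inter> {x. x $ k = t}"
  proof (intro equalityI subsetI)
    fix y assume y: "y \<in> A \<inter> {x. x $ k = t}"
    have "y - v \<in> (+) v -` A \<inter> {x. x $ k = t}" using y v by auto
    then show "y \<in> (+) v ` ((+) v -` A \<inter> {x. x $ k = t})" by (rule rev_image_eqI) simp
  qed (use v in auto)
  moreover have "(+) v -` A \<in> sets borel"
    using measurable_sets[of "(+) v" borel borel A] by simp
  ultimately show "emeasure (distr (slice_measure k t) borel ((+) v)) A = emeasure (slice_measure k t) A"
    using hausdorff_outer_measure_isometry[of "(+) v" _ "(+) v -` A \<inter> {x. x $ k = t}"]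
    by (simp add: emeasure_distr emeasure_slice_measure)
qed simp

text \<open>The union of the lines parallel to axis \<open>k\<close> through a facet; it meets each hyperplane
  \<open>x $ k = t\<close> in a translate of that facet.\<close>

definition slab :: "'n \<Rightarrow> real ^ 'n \<Rightarrow> real \<Rightarrow> (real ^ 'n) set" where
  "slab k p r = {x. \<forall>i. i \<noteq> k \<longrightarrow> p $ i \<le> x $ i \<and> x $ i \<le> p $ i + r}"

lemma slab_borel [measurable]: "slab k p r \<in> sets borel"
proof -
  have "slab k p r = {x. \<forall>i\<in>UNIV - {k}. p $ i \<le> x $ i \<and> x $ i \<le> p $ i + r}"
    by (auto simp: slab_def)
  also have "\<dots> \<in> sets borel" by simp
  finally show ?thesis .
qed

lemma emeasure_slice_measure_slab:
  fixes p :: "real ^ 'n"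
  shows "emeasure (slice_measure k t) (slab k p r)
    = hausdorff_outer_measure (CARD('n) - 1) (cube_face k (slice_lift k t p) r)"
proof -
  have "slab k p r \<inter> {x. x $ k = t} = cube_face k (slice_lift k t p) r"
    by (auto simp: slab_def cube_face_def slice_lift_nth)
  then show ?thesis by (simp add: emeasure_slice_measure)
qed

lemma sigma_finite_slice_measure: "sigma_finite_measure (slice_measure k t :: (real ^ 'n) measure)"
proof
  define A where "A j = slab k (\<chi> i. - (1 + real j)) (2 * (1 + real j))" for j :: nat
  have "x \<in> (\<Union>j. A j)" for x :: "real ^ 'n"
  proof -
    obtain j :: nat where j: "norm x < j" using reals_Archimedean2 by blast
    have "- (1 + real j) \<le> x $ i \<and> x $ i \<le> - (1 + real j) + 2 * (1 + real j)" for i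
      using component_le_norm_cart[of x i] j by (simp add: abs_le_iff)
    then have "x \<in> A j" by (simp only: A_def slab_def mem_Collect_eq vec_lambda_beta) blast
    then show ?thesis by blast
  qed
  then have "\<Union> (range A) = space (slice_measure k t)" by auto
  moreover have "emeasure (slice_measure k t) (A j) \<noteq> \<infinity>" for j
    unfolding A_def emeasure_slice_measure_slab
    by (intro less_imp_neq hausdorff_outer_measure_cube_face_finite) simp
  ultimately show "\<exists>A. countable A \<and> A \<subseteq> sets (slice_measure k t) \<and> \<Union> A = space (slice_measure k t)
      \<and> (\<forall>a\<in>A. emeasure (slice_measure k t) a \<noteq> \<infinity>)"
    by (intro exI[of _ "range A"]) (auto simp: A_def)
qed

text \<open>The measure \<open>A \<mapsto> \<integral> area (A \<inter> {x. x $ k = t}) dt\<close>, written as the image of a product measure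
  so that measurability in \<open>t\<close> and Fubini's theorem come for free.\<close>

definition stacked_measure :: "'n \<Rightarrow> (real ^ 'n) measure" where
  "stacked_measure k = distr (lborel \<Otimes>\<^sub>M slice_measure k 0) borel (\<lambda>(t, x). slice_lift k t x)"

lemma sets_stacked_measure [simp, measurable_cong]: "sets (stacked_measure k) = sets borel"
  by (simp add: stacked_measure_def)

lemma emeasure_stacked_measure_cube:
  fixes p :: "real ^ 'n"
  assumes r: "0 \<le> r"
  shows "emeasure (stacked_measure k) (cbox p (\<chi> i. p $ i + r))
    = ennreal r * hausdorff_outer_measure (CARD('n) - 1) (cube_face k (slice_lift k 0 p) r)"
proof -
  interpret sigma_finite_measure "slice_measure k 0 :: (real ^ 'n) measure"
    by (rule sigma_finite_slice_measure)
  have eq: "(\<lambda>(t, x). slice_lift k t x) -` cbox p (\<chi> i. p $ i + r) = {p $ k .. p $ k + r} \<times> slab k p r"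
    by (auto simp: slab_def mem_box_cart slice_lift_nth split: if_splits)
  have "emeasure (stacked_measure k) (cbox p (\<chi> i. p $ i + r))
      = emeasure (lborel \<Otimes>\<^sub>M slice_measure k 0) ({p $ k .. p $ k + r} \<times> slab k p r)"
    unfolding stacked_measure_def by (subst emeasure_distr) (simp_all add: eq space_pair_measure)
  also have "\<dots> = emeasure lborel {p $ k .. p $ k + r} * emeasure (slice_measure k 0) (slab k p r)"
    by (rule emeasure_pair_measure_Times) auto
  finally show ?thesis using r by (simp add: emeasure_slice_measure_slab)
qed

lemma sigma_finite_stacked_measure: "sigma_finite_measure (stacked_measure k :: (real ^ 'n) measure)"
proof
  define A where "A j = (let p = (\<chi> i. - (1 + real j)) :: real ^ 'n in cbox p (\<chi> i. p $ i + 2 * (1 + real j)))" for j :: nat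
  have "x \<in> (\<Union>j. A j)" for x :: "real ^ 'n"
  proof -
    obtain j :: nat where j: "norm x < j" using reals_Archimedean2 by blast
    have "- (1 + real j) \<le> x $ i \<and> x $ i \<le> - (1 + real j) + 2 * (1 + real j)" for i
      using component_le_norm_cart[of x i] j by (simp add: abs_le_iff)
    then have "x \<in> A j" by (simp only: A_def Let_def mem_box_cart vec_lambda_beta) blast
    then show ?thesis by blast
  qed
  then have "\<Union> (range A) = space (stacked_measure k)" by (auto simp: stacked_measure_def)
  moreover have "emeasure (stacked_measure k) (A j) \<noteq> \<infinity>" for j
  proof -
    define p :: "real ^ 'n" where "p = (\<chi> i. - (1 + real j))"
    define r where "r = 2 * (1 + real j)"
    have "0 < r" by (simp add: r_def)
    then have "emeasure (stacked_measure k) (A j) < \<infinity>"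
      unfolding A_def Let_def p_def[symmetric] r_def[symmetric]
      using hausdorff_outer_measure_cube_face_finite[of r k "slice_lift k 0 p"]
      by (subst emeasure_stacked_measure_cube) (auto simp: ennreal_mult_less_top)
    then show ?thesis by (rule less_imp_neq)
  qed
  ultimately show "\<exists>A. countable A \<and> A \<subseteq> sets (stacked_measure k) \<and> \<Union> A = space (stacked_measure k)
      \<and> (\<forall>a\<in>A. emeasure (stacked_measure k) a \<noteq> \<infinity>)"
    by (intro exI[of _ "range A"]) (auto simp: A_def Let_def)
qed

text \<open>A translation by \<open>v\<close> acts on the factors separately: it shifts the height by \<open>v $ k\<close> and
  each slice by the projection of \<open>v\<close> to \<open>x $ k = 0\<close>.\<close>

lemma distr_stacked_measure_translate: "distr (stacked_measure k) borel ((+) v) = stacked_measure k"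
proof -
  let ?P = "lborel \<Otimes>\<^sub>M slice_measure k 0"
  let ?\<phi> = "\<lambda>(t, x). slice_lift k t x"
  define w where "w = slice_lift k 0 v"
  have w: "w $ k = 0" by (simp add: w_def slice_lift_nth)
  have P: "distr ?P (borel \<Otimes>\<^sub>M borel) (\<lambda>(t, x). (v $ k + t, w + x)) = ?P"
    using pair_measure_distr[of "(+) (v $ k)" lborel borel "(+) w" "slice_measure k 0" borel]
    by (simp add: lborel_distr_plus distr_slice_measure_translate[OF w] sigma_finite_slice_measure)
  have "distr (stacked_measure k) borel ((+) v) = distr ?P borel (\<lambda>z. v + ?\<phi> z)"
    unfolding stacked_measure_def by (subst distr_distr) (auto simp: o_def)
  also have "(\<lambda>z. v + ?\<phi> z) = ?\<phi> \<circ> (\<lambda>(t, x). (v $ k + t, w + x))"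
    by (auto simp: fun_eq_iff vec_eq_iff slice_lift_nth w_def)
  also have "distr ?P borel (?\<phi> \<circ> (\<lambda>(t, x). (v $ k + t, w + x)))
      = distr (distr ?P (borel \<Otimes>\<^sub>M borel) (\<lambda>(t, x). (v $ k + t, w + x))) borel ?\<phi>"
    by (subst distr_distr) auto
  finally show ?thesis by (simp add: P stacked_measure_def)
qed

text \<open>The factor by which \<open>(n - 1)\<close>-dimensional Hausdorff measure on coordinate hyperplanes differs
  from Lebesgue measure. Only the fact that it is positive and finite will matter.\<close>

definition face_area :: "'n::finite \<Rightarrow> real" where
  "face_area k = enn2real (hausdorff_outer_measure (CARD('n) - 1) (cube_face k (0 :: real ^ 'n) 1))"

lemma face_area_pos: "0 < face_area k"
  using hausdorff_outer_measure_cube_face_pos[of 1 k 0] hausdorff_outer_measure_cube_face_finite[of 1 k 0]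
  by (simp add: face_area_def enn2real_positive_iff)

lemma stacked_measure_eq_lborel: "stacked_measure k = density lborel (\<lambda>_. ennreal (face_area k))"
proof -
  let ?U = "cbox (0 :: real ^ 'n) (\<chi> i. 1)"
  have "slice_lift k 0 0 = 0" by (simp add: slice_lift_def)
  then have "emeasure (stacked_measure k) ?U = ennreal (face_area k)"
    using emeasure_stacked_measure_cube[of 1 k 0] hausdorff_outer_measure_cube_face_finite[of 1 k 0]
    by (simp add: face_area_def less_top)
  moreover have "emeasure lborel ?U = 1" by (subst emeasure_lborel_cbox_cart) auto
  ultimately show ?thesis
    using translation_invariant_eq_lborel[OF _ sigma_finite_stacked_measure[of k] distr_stacked_measure_translate[of k], where U = ?U]
    by simp
qed

section \<open>Slicing integrals along a coordinate axis\<close>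

lemma coord_projection_open:
  fixes \<Omega> :: "(real ^ 'n) set"
  assumes "open \<Omega>"
  shows "open ((\<lambda>x. x $ k) ` \<Omega>)"
proof (rule open_surjective_linear_image[OF assms])
  show "linear (\<lambda>x :: real ^ 'n. x $ k)" by (rule linearI) auto
  show "surj (\<lambda>x :: real ^ 'n. x $ k)" by (rule surjI[of _ "\<lambda>t. \<chi> i. t"]) simp
qed

lemma coord_slice_pos:
  fixes \<Omega> :: "(real ^ 'n) set"
  assumes "open \<Omega>" and t: "t \<in> (\<lambda>x. x $ k) ` \<Omega>"
  shows "0 < emeasure surface_measure (\<Omega> \<inter> {x. x $ k = t})"
proof -
  obtain p where p: "p \<in> \<Omega>" "p $ k = t" using t by auto
  obtain e where e: "0 < e" "ball p e \<subseteq> \<Omega>" using assms(1) p by (meson open_contains_ball)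
  define r where "r = e / (2 * CARD('n))"
  have r: "0 < r" using e by (simp add: r_def)
  have "cube_face k p r \<subseteq> \<Omega> \<inter> {x. x $ k = t}"
  proof
    fix x assume x: "x \<in> cube_face k p r"
    have "\<bar>(p - x) $ i\<bar> \<le> r" for i
      using x r by (cases "i = k") (auto simp: cube_face_def abs_le_iff algebra_simps add_increasing2)
    then have "(\<Sum>i\<in>UNIV. \<bar>(p - x) $ i\<bar>) \<le> (\<Sum>i\<in>(UNIV :: 'n set). r)" by (intro sum_mono)
    also have "\<dots> < e" using e by (simp add: r_def)
    finally have "dist p x < e" using norm_le_l1_cart[of "p - x"] by (simp add: dist_norm)
    then show "x \<in> \<Omega> \<inter> {x. x $ k = t}" using x e p by (auto simp: cube_face_def)
  qed
  then have "0 < hausdorff_outer_measure (CARD('n) - 1) (\<Omega> \<inter> {x. x $ k = t})"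
    using hausdorff_outer_measure_cube_face_pos[OF r, of k p] hausdorff_outer_measure_mono
    by (meson order_less_le_trans)
  then show ?thesis
    using assms(1) by (subst emeasure_hausdorff_measure) (auto intro!: borel_in_sets_hausdorff_measure)
qed

text \<open>Fubini's theorem for the slices orthogonal to axis \<open>k\<close>. The function is first replaced by a
  Borel function equal to it almost everywhere; for almost every \<open>t\<close> the exceptional null set is
  also null on the slice at height \<open>t\<close>.\<close>

lemma coord_slicing:
  fixes f :: "real ^ 'n \<Rightarrow> real" and g :: "real \<Rightarrow> real"
  assumes op: "open \<Omega>" and c: "c \<noteq> 0"
    and f: "set_integrable lebesgue \<Omega> f"
    and slice: "\<And>t. 0 < emeasure surface_measure (\<Omega> \<inter> {x. x $ k = t})
      \<Longrightarrow> (LINT x:\<Omega> \<inter> {x. x $ k = t}|surface_measure. f x) = c"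
    and [measurable]: "g \<in> borel_measurable borel"
    and fg: "set_integrable lebesgue \<Omega> (\<lambda>x. f x * g (x $ k))"
  shows "face_area k * (LINT x:\<Omega>|lebesgue. f x * g (x $ k)) = c * (LINT t:(\<lambda>x. x $ k) ` \<Omega>|lborel. g t)"
proof -
  let ?S = "\<lambda>t. slice_measure k t"
  let ?\<phi> = "\<lambda>(t, x). slice_lift k t x"
  let ?I = "(\<lambda>x. x $ k) ` \<Omega>"
  interpret S: sigma_finite_measure "?S 0" by (rule sigma_finite_slice_measure)
  interpret P: pair_sigma_finite lborel "?S 0" ..
  define F0 where "F0 x = indicator \<Omega> x * f x" for x
  have "F0 \<in> borel_measurable (completion lborel)"
    using f by (simp add: F0_def[abs_def] set_integrable_def borel_measurable_integrable)
  then obtain F where F[measurable]: "F \<in> borel_measurable borel" and AEF: "AE x in lborel. F0 x = F x"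
    using completion_ex_borel_measurable_real by fastforce
  define G where "G x = F x * g (x $ k)" for x
  have G[measurable]: "G \<in> borel_measurable borel" unfolding G_def by measurable
  have AEG: "AE x in lebesgue. indicator \<Omega> x *\<^sub>R (f x * g (x $ k)) = G x"
    using AE_completion[OF AEF] by eventually_elim (simp add: F0_def G_def)
  have G': "G \<in> borel_measurable lebesgue" using G by (simp add: measurable_completion)
  have fg': "integrable lebesgue (\<lambda>x. indicator \<Omega> x *\<^sub>R (f x * g (x $ k)))"
    using fg by (simp add: set_integrable_def)
  have "integrable lebesgue G"
    by (rule integrable_cong_AE_imp[OF fg' G' AEG])
  then have intG: "integrable lborel G" by (simp add: integrable_completion)
  have "(LINT x:\<Omega>|lebesgue. f x * g (x $ k)) = (LINT x|lebesgue. G x)"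
    unfolding set_lebesgue_integral_def
    by (rule integral_cong_AE[OF borel_measurable_integrable[OF fg'] G' AEG])
  also have "\<dots> = (LINT x|lborel. G x)" by (simp add: integral_completion)
  finally have lhs: "(LINT x:\<Omega>|lebesgue. f x * g (x $ k)) = (LINT x|lborel. G x)" .
  have fa: "0 \<le> face_area k" using face_area_pos[of k] by simp
  have intS: "integrable (stacked_measure k) G"
    unfolding stacked_measure_eq_lborel using intG fa by (subst integrable_density) auto
  then have intP: "integrable (lborel \<Otimes>\<^sub>M ?S 0) (\<lambda>z. G (?\<phi> z))"
    unfolding stacked_measure_def by (subst (asm) integrable_distr_eq) auto
  have lift: "(LINT x|?S 0. G (slice_lift k t x)) = (LINT y|?S t. G y)" for t
    using integral_distr[of "slice_lift k t" "?S 0" borel G] by (simp add: distr_slice_measure_lift)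
  have "face_area k * (LINT x|lborel. G x) = (LINT x|stacked_measure k. G x)"
    unfolding stacked_measure_eq_lborel using fa by (subst integral_density) auto
  also have "\<dots> = (LINT z|(lborel \<Otimes>\<^sub>M ?S 0). G (?\<phi> z))"
    unfolding stacked_measure_def by (subst integral_distr) auto
  also have "\<dots> = (LINT t|lborel. LINT x|?S 0. G (slice_lift k t x))"
    using P.integral_fst'[OF intP] by simp
  also have "\<dots> = (LINT t|lborel. LINT y|?S t. G y)"
    by (simp add: lift)
  also have "\<dots> = (LINT t|lborel. c * (indicator ?I t * g t))"
  proof (rule integral_cong_AE)
    show "(\<lambda>t. LINT y|?S t. G y) \<in> borel_measurable lborel"
      using borel_measurable_integrable[OF P.integrable_fst'[OF intP]] by (simp add: lift)
    have [measurable]: "?I \<in> sets borel" using coord_projection_open[OF op] by auto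
    show "(\<lambda>t. c * (indicator ?I t * g t)) \<in> borel_measurable lborel" by measurable
    obtain N where N: "{x. F0 x \<noteq> F x} \<subseteq> N" "emeasure lborel N = 0" and [measurable]: "N \<in> sets borel"
      using AE_E[OF AEF] by auto
    have "AE x in lborel. x \<notin> N" using N by (intro AE_not_in) (auto simp: null_sets_def)
    then have "AE x in stacked_measure k. x \<notin> N"
      unfolding stacked_measure_eq_lborel by (subst AE_density) auto
    then have "AE z in lborel \<Otimes>\<^sub>M ?S 0. ?\<phi> z \<notin> N"
      unfolding stacked_measure_def by (rule AE_distrD[rotated]) simp
    from P.AE_pair[OF this] have "AE t in lborel. AE x in ?S 0. slice_lift k t x \<notin> N" by simp
    then show "AE t in lborel. (LINT y|?S t. G y) = c * (indicator ?I t * g t)"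
    proof eventually_elim
      fix t assume "AE x in ?S 0. slice_lift k t x \<notin> N"
      then have "AE x in distr (?S 0) borel (slice_lift k t). x \<notin> N"
        by (subst AE_distr_iff) auto
      then have "AE x in surface_measure. x $ k = t \<longrightarrow> x \<notin> N"
        unfolding distr_slice_measure_lift by (rule AE_slice_measureD)
      then have AEt: "AE x in surface_measure. indicator {x. x $ k = t} x * F0 x = indicator {x. x $ k = t} x * F x"
        by eventually_elim (use N(1) in \<open>auto simp: indicator_def\<close>)
      have mF: "(\<lambda>x. indicator {x. x $ k = t} x * F x) \<in> borel_measurable (surface_measure :: (real ^ 'n) measure)"
        by (intro borel_measurable_hausdorff_measure) measurable
      have "(LINT y|?S t. G y) = (LINT x|surface_measure. g t * (indicator {x. x $ k = t} x * F x))"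
        unfolding integral_slice_measure[OF G]
        by (intro Bochner_Integration.integral_cong) (auto simp: G_def indicator_def)
      also have "\<dots> = g t * (LINT x|surface_measure. indicator {x. x $ k = t} x * F x)"
        by simp
      also have "(LINT x|surface_measure. indicator {x. x $ k = t} x * F x) = c * indicator ?I t"
      proof (cases "t \<in> ?I")
        case True
        have cc: "c = (LINT x|surface_measure. indicator {x. x $ k = t} x * F0 x)"
          unfolding slice[OF coord_slice_pos[OF op True], symmetric] set_lebesgue_integral_def
          by (intro Bochner_Integration.integral_cong) (auto simp: F0_def indicator_def)
        \<comment> \<open>A function that is not integrable has integral 0, so \<open>c \<noteq> 0\<close> forces integrability on the
          slice.\<close>
        then have "integrable surface_measure (\<lambda>x. indicator {x. x $ k = t} x * F0 x)"
          using c not_integrable_integral_eq by metis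
        then have "c = (LINT x|surface_measure. indicator {x. x $ k = t} x * F x)"
          unfolding cc by (intro integral_cong_AE[OF _ mF AEt] borel_measurable_integrable)
        then show ?thesis using True by simp
      next
        case False
        then have z: "indicator {x. x $ k = t} x * F0 x = 0" for x
          by (auto simp: F0_def indicator_def)
        have "AE x in surface_measure. indicator {x. x $ k = t} x * F x = 0"
          using AEt unfolding z by (rule eventually_mono) (rule sym)
        then have "(LINT x|surface_measure. indicator {x. x $ k = t} x * F x) = (LINT x|(surface_measure :: (real ^ 'n) measure). 0)"
          by (intro integral_cong_AE[OF mF]) auto
        then show ?thesis using False by simp
      qed
      finally show "(LINT y|?S t. G y) = c * (indicator ?I t * g t)" by (simp add: ac_simps)
    qed
  qed
  also have "\<dots> = c * (LINT t:?I|lborel. g t)" by (simp add: set_lebesgue_integral_def)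
  finally show ?thesis by (simp add: lhs)
qed

section \<open>Orthogonal invariance of Lebesgue measure\<close>

text \<open>The image of Lebesgue measure is translation invariant, hence a multiple of Lebesgue measure,
  and the unit ball, which is mapped to itself, shows that the factor is 1.\<close>

lemma distr_lborel_orthogonal:
  fixes T :: "'a::euclidean_space \<Rightarrow> 'a"
  assumes T: "orthogonal_transformation T"
  shows "distr lborel lborel T = lborel"
proof -
  let ?M = "distr lborel borel T"
  have lin: "linear T" using T by (rule orthogonal_transformation_linear)
  have [measurable]: "T \<in> borel_measurable borel"
    using lin by (intro borel_measurable_continuous_onI linear_continuous_on linear_conv_bounded_linear[THEN iffD1])
  have nrm: "norm (T x) = norm x" for x using T by (rule orthogonal_transformation_norm)
  have ball: "emeasure ?M (ball 0 r) = emeasure lborel (ball (0 :: 'a) r)" for r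
  proof -
    have "T -` ball 0 r = ball 0 r" by (auto simp: nrm)
    then show ?thesis by (simp add: emeasure_distr)
  qed
  have sf: "sigma_finite_measure ?M"
  proof
    have "x \<in> (\<Union>j::nat. ball 0 (real j))" for x :: 'a using reals_Archimedean2[of "norm x"] by auto
    then show "\<exists>A. countable A \<and> A \<subseteq> sets ?M \<and> \<Union> A = space ?M \<and> (\<forall>a\<in>A. emeasure ?M a \<noteq> \<infinity>)"
      using emeasure_lborel_ball_finite[of "0 :: 'a"]
      by (intro exI[of _ "range (\<lambda>j::nat. ball 0 (real j))"]) (auto simp: ball less_top)
  qed
  have inv: "distr ?M borel ((+) v) = ?M" for v
  proof -
    obtain w where w: "v = T w" using orthogonal_transformation_surj[OF T] by (metis surjD)
    have "distr ?M borel ((+) v) = distr lborel borel (\<lambda>x. T (w + x))"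
      by (simp add: distr_distr o_def w linear_add[OF lin])
    also have "\<dots> = distr (distr lborel borel ((+) w)) borel T"
      by (simp add: distr_distr o_def)
    finally show ?thesis by (simp add: lborel_distr_plus)
  qed
  have eq: "emeasure ?M (ball 0 1) * emeasure lborel A = emeasure ?M A * emeasure lborel (ball (0 :: 'a) 1)"
    if "A \<in> sets borel" for A
    by (rule translation_invariant_emeasure_swap[OF _ sf inv that]) auto
  show ?thesis
  proof (rule measure_eqI)
    fix A assume "A \<in> sets (distr lborel lborel T)"
    then have A: "A \<in> sets borel" by simp
    have "0 < measure lborel (ball (0 :: 'a) 1)" by (rule content_ball_pos) simp
    then have "emeasure lborel (ball (0 :: 'a) 1) \<noteq> 0"
      by (auto simp: measure_def enn2real_positive_iff)
    moreover have "emeasure lborel (ball (0 :: 'a) 1) \<noteq> top"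
      using emeasure_lborel_ball_finite[of "0 :: 'a" 1] by (simp add: less_top)
    ultimately have "emeasure ?M A = emeasure lborel A"
      using eq[OF A] by (simp add: ball mult.commute[of _ "emeasure lborel (ball 0 1)"] ennreal_mult_cancel_left)
    moreover have "distr lborel lborel T = ?M" by (rule distr_cong) auto
    ultimately show "emeasure (distr lborel lborel T) A = emeasure lborel A" by simp
  qed simp
qed

lemma measurable_lebesgue_orthogonal:
  fixes T :: "'a::euclidean_space \<Rightarrow> 'a"
  assumes T: "orthogonal_transformation T"
  shows "T \<in> measurable lebesgue lebesgue" "distr lebesgue lebesgue T = lebesgue"
proof -
  have lin: "linear T" using T by (rule orthogonal_transformation_linear)
  have "T \<in> measurable lborel lborel"
    using lin by (simp add: borel_measurable_continuous_onI linear_continuous_on linear_conv_bounded_linear)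
  then have m: "T \<in> measurable lebesgue lborel" by (rule measurable_completion)
  have d: "distr lebesgue lborel T = lborel"
    using \<open>T \<in> measurable lborel lborel\<close> by (simp add: distr_completion distr_lborel_orthogonal[OF T])
  show "T \<in> measurable lebesgue lebesgue"
    using m by (rule completion.measurable_completion2) (simp add: d)
  show "distr lebesgue lebesgue T = lebesgue"
    using completion.completion_distr_eq[OF m] by (simp add: d)
qed

section \<open>Slicing integrals in an arbitrary direction\<close>

text \<open>Both Lebesgue and Hausdorff measure are invariant under a rotation that takes the fixed axis
  \<open>k\<close> to \<open>\<theta>\<close>. Hence the constant \<open>face_area k\<close> is the same for every direction \<open>\<theta>\<close>, so that
  widths of the domain in different directions can be compared.\<close>

lemma direction_slicing:
  fixes f :: "real ^ 'n \<Rightarrow> real" and g :: "real \<Rightarrow> real" and k :: 'n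
  assumes op: "open \<Omega>" and c: "c \<noteq> 0"
    and f: "set_integrable lebesgue \<Omega> f"
    and slice: "\<And>\<Sigma>. affine \<Sigma> \<Longrightarrow> aff_dim \<Sigma> = int CARD('n) - 1 \<Longrightarrow>
        0 < emeasure surface_measure (\<Omega> \<inter> \<Sigma>) \<Longrightarrow> (LINT x:\<Omega> \<inter> \<Sigma>|surface_measure. f x) = c"
    and g: "g \<in> borel_measurable borel" and \<theta>: "norm \<theta> = 1"
    and fg: "set_integrable lebesgue \<Omega> (\<lambda>x. f x * g (\<theta> \<bullet> x))"
  shows "face_area k * (LINT x:\<Omega>|lebesgue. f x * g (\<theta> \<bullet> x)) = c * (LINT t:(\<lambda>x. \<theta> \<bullet> x) ` \<Omega>|lborel. g t)"
proof -
  have "norm (axis k 1 :: real ^ 'n) = norm \<theta>" using \<theta> by simp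
  then obtain T :: "real ^ 'n \<Rightarrow> real ^ 'n" where T: "orthogonal_transformation T" and Tk: "T (axis k 1) = \<theta>"
    by (rule orthogonal_transformation_exists)
  have lin: "linear T" using T by (rule orthogonal_transformation_linear)
  have iso: "dist (T x) (T y) = dist x y" for x y
    by (simp add: dist_norm orthogonal_transformation_norm[OF T] flip: linear_diff[OF lin])
  have surj: "surj T" using T by (rule orthogonal_transformation_surj)
  have coord: "\<theta> \<bullet> T y = y $ k" for y
    using T by (simp add: orthogonal_transformation_def inner_axis' flip: Tk)
  define \<Omega>' where "\<Omega>' = T -` \<Omega>"
  note TL = measurable_lebesgue_orthogonal[OF T]
  have pull: "integrable lebesgue (\<lambda>y. h (T y))" "(LINT y|lebesgue. h (T y)) = (LINT x|lebesgue. h x)"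
    if h: "integrable lebesgue h" for h :: "real ^ 'n \<Rightarrow> real"
  proof -
    have m: "h \<in> borel_measurable lebesgue" using h by (rule borel_measurable_integrable)
    show "integrable lebesgue (\<lambda>y. h (T y))"
      using h integrable_distr_eq[OF TL(1) m] by (simp add: TL(2))
    show "(LINT y|lebesgue. h (T y)) = (LINT x|lebesgue. h x)"
      using integral_distr[OF TL(1) m] by (simp add: TL(2))
  qed
  have "face_area k * (LINT y:\<Omega>'|lebesgue. f (T y) * g (y $ k)) = c * (LINT t:(\<lambda>y. y $ k) ` \<Omega>'|lborel. g t)"
  proof (rule coord_slicing)
    show "open \<Omega>'" unfolding \<Omega>'_def
      using op lin by (intro open_vimage linear_continuous_on linear_conv_bounded_linear[THEN iffD1])
    show "c \<noteq> 0" "g \<in> borel_measurable borel" by fact+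
    show "set_integrable lebesgue \<Omega>' (\<lambda>y. f (T y))"
      using pull(1)[OF f[unfolded set_integrable_def]]
      by (simp add: set_integrable_def \<Omega>'_def indicator_def)
    show "set_integrable lebesgue \<Omega>' (\<lambda>y. f (T y) * g (y $ k))"
      using pull(1)[OF fg[unfolded set_integrable_def]]
      by (simp add: set_integrable_def \<Omega>'_def indicator_def coord)
    fix t assume pos: "0 < emeasure surface_measure (\<Omega>' \<inter> {x. x $ k = t})"
    let ?P = "{x. \<theta> \<bullet> x = t}" and ?H = "surface_measure :: (real ^ 'n) measure"
    define h where "h x = indicator (\<Omega> \<inter> ?P) x *\<^sub>R f x" for x
    have eq: "T -` (\<Omega> \<inter> ?P) = \<Omega>' \<inter> {x. x $ k = t}" by (auto simp: \<Omega>'_def coord)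
    note TH = measurable_isometry_hausdorff_measure[of T, OF iso surj]
      and dTH = distr_hausdorff_measure_isometry[of T, OF iso surj]
    have "closed ?P" by (rule closed_hyperplane)
    then have "\<Omega> \<inter> ?P \<in> sets ?H" using op by (intro borel_in_sets_hausdorff_measure) auto
    then have "emeasure ?H (\<Omega> \<inter> ?P) = emeasure ?H (\<Omega>' \<inter> {x. x $ k = t})"
      using emeasure_distr[OF TH, of "\<Omega> \<inter> ?P" "CARD('n) - 1"] by (simp add: dTH eq[symmetric])
    moreover have "aff_dim ?P = int CARD('n) - 1" using \<theta> by (subst aff_dim_hyperplane) auto
    ultimately have ch: "c = (LINT x|?H. h x)"
      using slice[of ?P] pos by (simp add: affine_hyperplane h_def set_lebesgue_integral_def)
    then have "integrable ?H h" using c not_integrable_integral_eq by metis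
    then have "(LINT x|?H. h x) = (LINT y|?H. h (T y))"
      using integral_distr[OF TH borel_measurable_integrable, of "CARD('n) - 1" h] by (simp add: dTH)
    also have "\<dots> = (LINT y:\<Omega>' \<inter> {x. x $ k = t}|?H. f (T y))"
      unfolding set_lebesgue_integral_def
      by (intro Bochner_Integration.integral_cong) (auto simp: h_def eq[symmetric] indicator_def)
    finally show "(LINT y:\<Omega>' \<inter> {x. x $ k = t}|?H. f (T y)) = c" using ch by simp
  qed
  moreover have "(LINT y:\<Omega>'|lebesgue. f (T y) * g (y $ k)) = (LINT x:\<Omega>|lebesgue. f x * g (\<theta> \<bullet> x))"
    using pull(2)[OF fg[unfolded set_integrable_def]]
    by (simp add: set_lebesgue_integral_def \<Omega>'_def indicator_def coord)
  moreover have "(\<lambda>y. y $ k) ` \<Omega>' = (\<lambda>x. \<theta> \<bullet> x) ` \<Omega>"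
  proof (intro equalityI subsetI)
    fix t assume "t \<in> (\<lambda>x. \<theta> \<bullet> x) ` \<Omega>"
    then obtain x where x: "x \<in> \<Omega>" "t = \<theta> \<bullet> x" by auto
    obtain y where "x = T y" using surj by (metis surjD)
    then show "t \<in> (\<lambda>y. y $ k) ` \<Omega>'" using x by (auto simp: \<Omega>'_def coord)
  qed (auto simp: \<Omega>'_def simp flip: coord)
  ultimately show ?thesis by simp
qed

section \<open>Intervals on the line\<close>

lemma open_connected_bounded_real:
  fixes S :: "real set"
  assumes "open S" "connected S" "bounded S" "S \<noteq> {}"
  shows "S = {Inf S<..<Sup S}" "Inf S < Sup S"
proof -
  have bdd: "bdd_above S" "bdd_below S" using assms(3) by (auto simp: bounded_imp_bdd_above bounded_imp_bdd_below)
  show eq: "S = {Inf S<..<Sup S}"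
  proof (intro equalityI subsetI)
    fix x assume x: "x \<in> S"
    obtain e where e: "0 < e" "cball x e \<subseteq> S" using assms(1) x by (meson open_contains_cball)
    have "x - e \<in> S" "x + e \<in> S" using e by (auto simp: subset_iff dist_real_def)
    then have "Inf S \<le> x - e" "x + e \<le> Sup S" using bdd by (auto intro: cInf_lower cSup_upper)
    then show "x \<in> {Inf S<..<Sup S}" using e by auto
  next
    fix x assume "x \<in> {Inf S<..<Sup S}"
    then obtain a b where "a \<in> S" "a < x" "b \<in> S" "x < b"
      using assms(4) bdd by (auto simp: cInf_less_iff less_cSup_iff)
    then show "x \<in> S" using connectedD_interval[OF assms(2), of a b x] by auto
  qed
  show "Inf S < Sup S" using eq assms(4) by auto
qed

lemma integral_open_interval_cases:
  fixes a b :: real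
  assumes "a < b"
  shows "(LINT t:{a<..<b}|lborel. (1::real)) = b - a"
    and "(LINT t:{a<..<b}|lborel. t) = (b\<^sup>2 - a\<^sup>2) / 2"
    and "0 < e \<Longrightarrow> e \<le> b - a \<Longrightarrow> (LINT t:{a<..<b}|lborel. indicator {b - e<..} t :: real) = e"
proof -
  show "(LINT t:{a<..<b}|lborel. (1::real)) = b - a"
    using assms by (simp add: set_lebesgue_integral_def)
  have "set_integrable lborel {a..b} (\<lambda>t. t)"
    by (intro borel_integrable_atLeastAtMost' continuous_intros)
  then have "set_integrable lborel {a<..<b} (\<lambda>t. t)"
    by (rule set_integrable_subset) auto
  then have "(LINT t:{a<..<b}|lborel. t) = integral {a<..<b} (\<lambda>t. t)"
    by (rule set_borel_integral_eq_integral)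
  also have "\<dots> = (b\<^sup>2 - a\<^sup>2) / 2"
    using ident_has_integral[of a b] assms
    by (simp add: integral_open_interval_real[symmetric] integral_unique)
  finally show "(LINT t:{a<..<b}|lborel. t) = (b\<^sup>2 - a\<^sup>2) / 2" .
  assume e: "0 < e" "e \<le> b - a"
  then have "(LINT t:{a<..<b}|lborel. indicator {b - e<..} t :: real) = (LINT t|lborel. indicator {b - e<..<b} t :: real)"
    unfolding set_lebesgue_integral_def
    by (intro Bochner_Integration.integral_cong) (auto simp: indicator_def)
  then show "(LINT t:{a<..<b}|lborel. indicator {b - e<..} t :: real) = e" using e by simp
qed

section \<open>Disjoint caps of a ball\<close>

text \<open>The points of the unit sphere of a three-dimensional coordinate subspace above a square grid
  of mesh \<open>1 / (2 * m)\<close> in \<open>{0..1/2} \<times> {0..1/2}\<close>. Their number grows like the inverse square of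
  their separation, which is what dimension at least three provides: on a circle it grows only like
  the inverse.\<close>

lemma separated_unit_vectors:
  fixes m :: nat
  assumes card: "CARD('n) \<ge> 3" and m: "0 < m"
  obtains \<theta> :: "nat \<times> nat \<Rightarrow> real ^ 'n"
  where "\<And>p. p \<in> {..<m} \<times> {..<m} \<Longrightarrow> norm (\<theta> p) = 1"
    and "\<And>p q. p \<noteq> q \<Longrightarrow> 1 / (2 * m) \<le> norm (\<theta> p - \<theta> q)"
proof -
  obtain A :: "'n set" where "card A = 3" using card by (meson obtain_subset_with_card_n)
  then obtain i j l :: 'n where ne: "i \<noteq> j" "i \<noteq> l" "j \<noteq> l" by (auto simp: card_3_iff)
  define u where "u a = real a / (2 * m)" for a :: nat
  define \<theta> :: "nat \<times> nat \<Rightarrow> real ^ 'n" where "\<theta> p = u (fst p) *\<^sub>R axis i 1 + u (snd p) *\<^sub>R axis j 1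
      + sqrt (1 - (u (fst p))\<^sup>2 - (u (snd p))\<^sup>2) *\<^sub>R axis l 1" for p
  show ?thesis
  proof
    fix p :: "nat \<times> nat" assume p: "p \<in> {..<m} \<times> {..<m}"
    have small: "(u a)\<^sup>2 \<le> 1 / 4" if "a < m" for a
    proof -
      have "0 \<le> u a" "u a \<le> 1 / 2" using that m by (auto simp: u_def field_simps)
      then have "(u a)\<^sup>2 \<le> (1 / 2)\<^sup>2" by (intro power_mono)
      then show ?thesis by (simp add: power_divide)
    qed
    have "0 \<le> 1 - (u (fst p))\<^sup>2 - (u (snd p))\<^sup>2" using p small[of "fst p"] small[of "snd p"] by auto
    then have "\<theta> p \<bullet> \<theta> p = 1"
      using ne by (simp add: \<theta>_def inner_add_left inner_add_right inner_axis_axis power2_eq_square)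
    then show "norm (\<theta> p) = 1" by (simp add: norm_eq_1)
  next
    fix p q :: "nat \<times> nat" assume "p \<noteq> q"
    have sep: "1 / (2 * m) \<le> \<bar>u a - u b\<bar>" if "a \<noteq> b" for a b
    proof -
      have "\<bar>u a - u b\<bar> = \<bar>real a - real b\<bar> / (2 * m)"
        using m by (simp add: u_def abs_divide flip: diff_divide_distrib)
      moreover have "1 \<le> \<bar>real a - real b\<bar>" using that by linarith
      ultimately show ?thesis by (simp add: divide_right_mono)
    qed
    have "(\<theta> p - \<theta> q) $ i = u (fst p) - u (fst q)" "(\<theta> p - \<theta> q) $ j = u (snd p) - u (snd q)"
      using ne by (auto simp: \<theta>_def axis_def)
    then have "\<bar>u (fst p) - u (fst q)\<bar> \<le> norm (\<theta> p - \<theta> q)" "\<bar>u (snd p) - u (snd q)\<bar> \<le> norm (\<theta> p - \<theta> q)"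
      using component_le_norm_cart[of "\<theta> p - \<theta> q"] by metis+
    then show "1 / (2 * m) \<le> norm (\<theta> p - \<theta> q)"
      using sep[of "fst p" "fst q"] sep[of "snd p" "snd q"] \<open>p \<noteq> q\<close>
      by (meson order_trans prod_eqI)
  qed
qed

text \<open>A cap of height \<open>e\<close> of a ball of radius \<open>R\<close> lies within distance \<open>sqrt (2 * R * e)\<close> of its
  pole, so about \<open>1 / e\<close> caps of height \<open>e\<close> can be chosen pairwise disjoint. Their integrals
  \<open>C * e\<close> add up to an amount bounded away from 0, yet all these caps lie in a shell of thickness
  \<open>e\<close> along the sphere, over which the integral of \<open>\<bar>f\<bar>\<close> tends to 0.\<close>

lemma cap_integral_contradiction:
  fixes f :: "real ^ 'n \<Rightarrow> real"
  assumes card: "CARD('n) \<ge> 3" and op: "open \<Omega>" and f: "set_integrable lebesgue \<Omega> f"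
    and R: "0 < R" and sub: "\<Omega> \<subseteq> ball z R" and C: "C \<noteq> 0"
    and cap: "\<And>\<theta> e. norm \<theta> = 1 \<Longrightarrow> 0 < e \<Longrightarrow> e < R \<Longrightarrow>
      (LINT x:\<Omega> \<inter> {x. R - e < \<theta> \<bullet> (x - z)}|lebesgue. f x) = C * e"
  shows False
proof -
  \<comment> \<open>This height makes caps stay within \<open>R / (4 * m)\<close> of their poles, half the least distance between
    the poles of different grid directions.\<close>
  define e where "e m = R / (32 * (real m)\<^sup>2)" for m :: nat
  define F where "F x = indicator \<Omega> x * f x" for x
  define shell where "shell m = \<Omega> \<inter> {x. R - e m < norm (x - z)}" for m
  have F: "integrable lebesgue F" using f by (simp add: F_def[abs_def] set_integrable_def)
  have shell_meas: "shell m \<in> sets lebesgue" for m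
  proof -
    have "open {x. R - e m < norm (x - z)}" by (intro open_Collect_less continuous_intros)
    then have "open (shell m)" using op by (auto simp: shell_def)
    then show ?thesis by simp
  qed
  have lower: "\<bar>C\<bar> * R / 32 \<le> (LINT x|lebesgue. indicator (shell m) x * \<bar>F x\<bar>)" if m: "0 < m" for m
  proof -
    have "1 \<le> (real m)\<^sup>2" using m by (simp add: one_le_power)
    then have "R / (32 * (real m)\<^sup>2) \<le> R / (32 * 1)"
      using R m by (intro divide_left_mono) auto
    then have em: "0 < e m" "e m < R" using R m by (auto simp: e_def)
    obtain \<theta> :: "nat \<times> nat \<Rightarrow> real ^ 'n"
      where unit: "\<And>p. p \<in> {..<m} \<times> {..<m} \<Longrightarrow> norm (\<theta> p) = 1"
        and sep: "\<And>p q. p \<noteq> q \<Longrightarrow> 1 / (2 * m) \<le> norm (\<theta> p - \<theta> q)"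
      using separated_unit_vectors[OF card m] by blast
    let ?J = "{..<m} \<times> {..<m}"
    define K where "K p = \<Omega> \<inter> {x. R - e m < \<theta> p \<bullet> (x - z)}" for p
    have K_meas: "K p \<in> sets lebesgue" for p
    proof -
      have "open {x. R - e m < \<theta> p \<bullet> (x - z)}" by (intro open_Collect_less continuous_intros)
      then have "open (K p)" using op by (auto simp: K_def)
      then show ?thesis by simp
    qed
    have near: "norm (x - z - R *\<^sub>R \<theta> p) < R / (4 * m)" if "p \<in> ?J" "x \<in> K p" for p x
    proof -
      have "norm (x - z) < R" using that sub by (auto simp: K_def dist_norm norm_minus_commute)
      then have "(norm (x - z))\<^sup>2 < R\<^sup>2" by (intro power_strict_mono) auto
      have "(norm (x - z - R *\<^sub>R \<theta> p))\<^sup>2 = (norm (x - z))\<^sup>2 - 2 * R * (\<theta> p \<bullet> (x - z)) + R\<^sup>2 * (norm (\<theta> p))\<^sup>2"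
        by (simp only: power2_norm_eq_inner) (simp add: inner_diff_left inner_diff_right inner_commute power2_eq_square algebra_simps)
      also have "\<dots> = (norm (x - z))\<^sup>2 - 2 * R * (\<theta> p \<bullet> (x - z)) + R\<^sup>2" using unit[OF that(1)] by simp
      also have "\<dots> < R\<^sup>2 - 2 * R * (R - e m) + R\<^sup>2"
      proof -
        have "2 * R * (R - e m) \<le> 2 * R * (\<theta> p \<bullet> (x - z))"
          using that R by (intro mult_left_mono) (auto simp: K_def)
        then show ?thesis using \<open>(norm (x - z))\<^sup>2 < R\<^sup>2\<close> by linarith
      qed
      also have "\<dots> = (R / (4 * m))\<^sup>2"
        using m by (simp add: e_def power2_eq_square field_simps)
      finally show ?thesis using R by (simp add: power_less_imp_less_base)
    qed
    have disj: "disjoint_family_on K ?J"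
      unfolding disjoint_family_on_def
    proof (intro ballI impI, rule ccontr)
      fix p q assume pq: "p \<in> ?J" "q \<in> ?J" "p \<noteq> q" and "K p \<inter> K q \<noteq> {}"
      then obtain x where x: "x \<in> K p" "x \<in> K q" by blast
      have "R * norm (\<theta> p - \<theta> q) = norm ((x - z - R *\<^sub>R \<theta> q) - (x - z - R *\<^sub>R \<theta> p))"
        using R by (simp add: algebra_simps flip: scaleR_diff_right)
      also have "\<dots> \<le> norm (x - z - R *\<^sub>R \<theta> q) + norm (x - z - R *\<^sub>R \<theta> p)" by (rule norm_triangle_ineq4)
      also have "\<dots> < R / (4 * m) + R / (4 * m)" using near pq x by (intro add_strict_mono) auto
      also have "\<dots> = R * (1 / (2 * m))" by simp
      finally have "norm (\<theta> p - \<theta> q) < 1 / (2 * m)" using R by (simp only: mult_less_cancel_left_pos)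
      then show False using sep[OF pq(3)] by simp
    qed
    have K_shell: "(\<Sum>p\<in>?J. indicator (K p) x) \<le> (indicator (shell m) x :: real)" for x
    proof -
      have "(\<Sum>p\<in>?J. indicator (K p) x) = (indicator (\<Union>p\<in>?J. K p) x :: real)"
        by (rule indicator_UN_disjoint[symmetric]) (use disj in auto)
      also have "\<dots> \<le> indicator (shell m) x"
      proof -
        have "x \<in> shell m" if "p \<in> ?J" "x \<in> K p" for p x
          using norm_cauchy_schwarz[of "\<theta> p" "x - z"] unit[OF that(1)] that(2)
          by (simp add: K_def shell_def)
        then have "(\<Union>p\<in>?J. K p) \<subseteq> shell m" by blast
        then show ?thesis by (auto simp: indicator_def)
      qed
      finally show ?thesis .
    qed
    have int: "integrable lebesgue (\<lambda>x. indicator A x * \<bar>F x\<bar>)" if "A \<in> sets lebesgue" for A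
      using integrable_mult_indicator[OF that integrable_abs[OF F]] by simp
    have "\<bar>C\<bar> * R / 32 = (\<Sum>p\<in>?J. \<bar>C * e m\<bar>)"
      using m R by (simp add: e_def abs_mult power2_eq_square)
    also have "\<dots> \<le> (\<Sum>p\<in>?J. LINT x|lebesgue. indicator (K p) x * \<bar>F x\<bar>)"
    proof (rule sum_mono)
      fix p assume p: "p \<in> ?J"
      have "C * e m = (LINT x|lebesgue. indicator (K p) x * F x)"
        unfolding cap[OF unit[OF p] em, symmetric] set_lebesgue_integral_def
        by (intro Bochner_Integration.integral_cong) (auto simp: K_def F_def indicator_def)
      then have "\<bar>C * e m\<bar> \<le> (LINT x|lebesgue. \<bar>indicator (K p) x * F x\<bar>)"
        using integral_abs_bound by simp
      also have "\<dots> = (LINT x|lebesgue. indicator (K p) x * \<bar>F x\<bar>)" by (simp add: abs_mult)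
      finally show "\<bar>C * e m\<bar> \<le> (LINT x|lebesgue. indicator (K p) x * \<bar>F x\<bar>)" .
    qed
    also have "\<dots> = (LINT x|lebesgue. (\<Sum>p\<in>?J. indicator (K p) x * \<bar>F x\<bar>))"
      by (rule Bochner_Integration.integral_sum[symmetric]) (rule int[OF K_meas])
    also have "\<dots> \<le> (LINT x|lebesgue. indicator (shell m) x * \<bar>F x\<bar>)"
      unfolding sum_distrib_right[symmetric]
    proof (rule integral_mono)
      show "integrable lebesgue (\<lambda>x. (\<Sum>p\<in>?J. indicator (K p) x) * \<bar>F x\<bar>)"
        unfolding sum_distrib_right by (intro Bochner_Integration.integrable_sum int K_meas)
    qed (auto intro: int shell_meas mult_right_mono K_shell)
    finally show ?thesis .
  qed
  have "(\<lambda>m. LINT x|lebesgue. indicator (shell (Suc m)) x * \<bar>F x\<bar>) \<longlonglongrightarrow> (LINT x|(lebesgue :: (real ^ 'n) measure). 0)"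
  proof (rule integral_dominated_convergence[where w = "\<lambda>x. \<bar>F x\<bar>"])
    show "(\<lambda>x. indicator (shell (Suc m)) x * \<bar>F x\<bar>) \<in> borel_measurable lebesgue" for m
      using borel_measurable_integrable[OF F] shell_meas by measurable
    show "AE x in lebesgue. (\<lambda>m. indicator (shell (Suc m)) x * \<bar>F x\<bar>) \<longlonglongrightarrow> 0"
    proof (rule AE_I2)
      fix x
      show "(\<lambda>m. indicator (shell (Suc m)) x * \<bar>F x\<bar>) \<longlonglongrightarrow> 0"
      proof (cases "x \<in> \<Omega>")
        case True
        then have "0 < R - norm (x - z)" using sub by (auto simp: dist_norm norm_minus_commute)
        moreover have "(\<lambda>m. e (Suc m)) \<longlonglongrightarrow> 0"
        proof -
          have "(\<lambda>m. R / 32 * (inverse (real (Suc m)) * inverse (real (Suc m)))) \<longlonglongrightarrow> R / 32 * (0 * 0)"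
            by (intro tendsto_intros LIMSEQ_inverse_real_of_nat)
          then show ?thesis by (simp add: e_def[abs_def] field_simps power2_eq_square)
        qed
        ultimately have "\<forall>\<^sub>F m in sequentially. e (Suc m) < R - norm (x - z)" by (rule order_tendstoD(2)[rotated])
        then have "\<forall>\<^sub>F m in sequentially. indicator (shell (Suc m)) x * \<bar>F x\<bar> = 0"
          by eventually_elim (simp add: shell_def)
        then show ?thesis by (rule tendsto_eventually)
      qed (simp add: F_def)
    qed
    show "AE x in lebesgue. norm (indicator (shell (Suc m)) x * \<bar>F x\<bar>) \<le> \<bar>F x\<bar>" for m
      by (rule AE_I2) (simp add: indicator_def)
  qed (use integrable_abs[OF F] in auto)
  then have "\<bar>C\<bar> * R / 32 \<le> (LINT x|(lebesgue :: (real ^ 'n) measure). 0)"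
    by (rule LIMSEQ_le_const) (use lower in auto)
  then show False using C R by (simp add: mult_le_0_iff)
qed

section \<open>Functions with constant integrals over hyperplane sections\<close>

theorem mainTheorem2:
  fixes \<Omega> :: "(real ^ 'n) set" and c :: real
  assumes "CARD('n) \<ge> 3"
    and "\<Omega> \<noteq> {}" and "open \<Omega>" and "connected \<Omega>" and "convex \<Omega>" and "bounded \<Omega>"
    and "c \<noteq> 0"
  shows "\<not> (\<exists>f :: real ^ 'n \<Rightarrow> real.
    set_integrable lebesgue \<Omega> f \<and>
    (\<forall>\<Sigma>. affine \<Sigma> \<and> aff_dim \<Sigma> = int CARD('n) - 1 \<and>
         emeasure (hausdorff_measure (CARD('n) - 1)) (\<Omega> \<inter> \<Sigma>) > 0 \<longrightarrow>
         (LINT x:\<Omega> \<inter> \<Sigma>|hausdorff_measure (CARD('n) - 1). f x) = c))"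
proof
  assume "\<exists>f :: real ^ 'n \<Rightarrow> real. set_integrable lebesgue \<Omega> f \<and>
    (\<forall>\<Sigma>. affine \<Sigma> \<and> aff_dim \<Sigma> = int CARD('n) - 1 \<and>
         emeasure (hausdorff_measure (CARD('n) - 1)) (\<Omega> \<inter> \<Sigma>) > 0 \<longrightarrow>
         (LINT x:\<Omega> \<inter> \<Sigma>|hausdorff_measure (CARD('n) - 1). f x) = c)"
  then obtain f :: "real ^ 'n \<Rightarrow> real" where f: "set_integrable lebesgue \<Omega> f"
    and slice: "\<And>\<Sigma>. affine \<Sigma> \<Longrightarrow> aff_dim \<Sigma> = int CARD('n) - 1 \<Longrightarrow>
        0 < emeasure surface_measure (\<Omega> \<inter> \<Sigma>) \<Longrightarrow> (LINT x:\<Omega> \<inter> \<Sigma>|surface_measure. f x) = c"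
    by blast
  \<comment> \<open>An arbitrary axis, fixed to normalise the area measure.\<close>
  define k :: 'n where "k = undefined"
  define C where "C = c / face_area k"
  have C: "C \<noteq> 0" using \<open>c \<noteq> 0\<close> face_area_pos[of k] by (simp add: C_def)
  have F: "integrable lebesgue (\<lambda>x. indicator \<Omega> x * f x)" using f by (simp add: set_integrable_def)
  obtain B where B: "\<And>x. x \<in> \<Omega> \<Longrightarrow> norm x \<le> B" using \<open>bounded \<Omega>\<close> by (auto simp: bounded_iff)
  have fv: "integrable lebesgue (\<lambda>x. (indicator \<Omega> x * f x) *\<^sub>R x)"
  proof (rule Bochner_Integration.integrable_bound)
    show "integrable lebesgue (\<lambda>x. B * (indicator \<Omega> x * f x))" using F by (rule integrable_mult_right)
    have "(\<lambda>x. x) \<in> borel_measurable (lebesgue :: (real ^ 'n) measure)" by (simp add: measurable_completion)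
    then show "(\<lambda>x. (indicator \<Omega> x * f x) *\<^sub>R x) \<in> borel_measurable lebesgue"
      using borel_measurable_integrable[OF F] by (rule borel_measurable_scaleR[rotated])
    have "norm ((indicator \<Omega> x * f x) *\<^sub>R x) \<le> norm (B * (indicator \<Omega> x * f x))" for x
    proof (cases "x \<in> \<Omega>")
      case True
      then have "norm x \<le> \<bar>B\<bar>" using B[of x] by linarith
      then have "norm x * \<bar>f x\<bar> \<le> \<bar>B\<bar> * \<bar>f x\<bar>" by (rule mult_right_mono) simp
      then show ?thesis using True by (simp add: abs_mult mult.commute)
    qed simp
    then show "AE x in lebesgue. norm ((indicator \<Omega> x * f x) *\<^sub>R x) \<le> norm (B * (indicator \<Omega> x * f x))"
      by simp
  qed
  define v where "v = (LINT x|lebesgue. (indicator \<Omega> x * f x) *\<^sub>R x)"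
  define M0 where "M0 = (LINT x:\<Omega>|lebesgue. f x)"
  define a where "a \<theta> = Inf ((\<lambda>x. \<theta> \<bullet> x) ` \<Omega>)" for \<theta>
  define b where "b \<theta> = Sup ((\<lambda>x. \<theta> \<bullet> x) ` \<Omega>)" for \<theta>
  have interval: "(\<lambda>x. \<theta> \<bullet> x) ` \<Omega> = {a \<theta><..<b \<theta>}" "a \<theta> < b \<theta>" if \<theta>: "norm \<theta> = 1" for \<theta>
  proof -
    let ?S = "(\<lambda>x. \<theta> \<bullet> x) ` \<Omega>"
    have "surj (\<lambda>x. \<theta> \<bullet> x)"
      by (rule surjI[of _ "\<lambda>t. t *\<^sub>R \<theta>"]) (use \<theta> in \<open>simp add: norm_eq_1\<close>)
    then have "open ?S"
      by (rule open_surjective_linear_image[OF \<open>open \<Omega>\<close> bounded_linear.linear[OF bounded_linear_inner_right]])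
    moreover have "connected ?S"
      by (intro connected_continuous_image continuous_intros \<open>connected \<Omega>\<close>)
    moreover have "bounded ?S"
      by (rule bounded_linear_image[OF \<open>bounded \<Omega>\<close> bounded_linear_inner_right])
    ultimately show "?S = {a \<theta><..<b \<theta>}" "a \<theta> < b \<theta>"
      using open_connected_bounded_real[of ?S] \<open>\<Omega> \<noteq> {}\<close> by (simp_all add: a_def b_def)
  qed
  have radon: "(LINT x:\<Omega>|lebesgue. f x * g (\<theta> \<bullet> x)) = C * (LINT t:{a \<theta><..<b \<theta>}|lborel. g t)"
    if \<theta>: "norm \<theta> = 1" and g: "g \<in> borel_measurable borel"
      and fg: "set_integrable lebesgue \<Omega> (\<lambda>x. f x * g (\<theta> \<bullet> x))" for \<theta> g
    using direction_slicing[OF \<open>open \<Omega>\<close> \<open>c \<noteq> 0\<close> f slice g \<theta> fg, of k] interval[OF \<theta>] face_area_pos[of k]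
    by (simp add: C_def field_simps)
  \<comment> \<open>Moments of order 0 and 1 of the marginal in direction \<open>\<theta>\<close>: the first is independent of \<open>\<theta>\<close>,
    the second is linear in \<open>\<theta>\<close>.\<close>
  have width: "M0 = C * (b \<theta> - a \<theta>)" if \<theta>: "norm \<theta> = 1" for \<theta>
    using radon[OF \<theta>, of "\<lambda>_. 1"] f interval[OF \<theta>] by (simp add: M0_def integral_open_interval_cases(1))
  have inner_eq: "indicator \<Omega> x *\<^sub>R (f x * (\<theta> \<bullet> x)) = \<theta> \<bullet> ((indicator \<Omega> x * f x) *\<^sub>R x)" for \<theta> x
    by simp
  have moment: "\<theta> \<bullet> v = C * ((b \<theta>)\<^sup>2 - (a \<theta>)\<^sup>2) / 2" if \<theta>: "norm \<theta> = 1" for \<theta>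
  proof -
    have "set_integrable lebesgue \<Omega> (\<lambda>x. f x * (\<theta> \<bullet> x))"
      unfolding set_integrable_def inner_eq using fv by (rule integrable_inner_right)
    then have "(LINT x:\<Omega>|lebesgue. f x * (\<theta> \<bullet> x)) = C * ((b \<theta>)\<^sup>2 - (a \<theta>)\<^sup>2) / 2"
      using radon[OF \<theta>, of "\<lambda>t. t"] interval[OF \<theta>] by (simp add: integral_open_interval_cases(2))
    moreover have "(LINT x:\<Omega>|lebesgue. f x * (\<theta> \<bullet> x)) = \<theta> \<bullet> v"
      unfolding set_lebesgue_integral_def inner_eq v_def using fv by (intro integral_inner_right)
    ultimately show ?thesis by simp
  qed
  define R where "R = M0 / (2 * C)"
  define z where "z = v /\<^sub>R M0"
  have ab: "a \<theta> = \<theta> \<bullet> z - R" "b \<theta> = \<theta> \<bullet> z + R" if \<theta>: "norm \<theta> = 1" for \<theta>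
  proof -
    have w: "b \<theta> - a \<theta> = 2 * R" using width[OF \<theta>] C by (simp add: R_def)
    have "M0 \<noteq> 0" using width[OF \<theta>] interval(2)[OF \<theta>] C by simp
    have "\<theta> \<bullet> v = C * (b \<theta> - a \<theta>) * (b \<theta> + a \<theta>) / 2"
      using moment[OF \<theta>] by (simp add: power2_eq_square algebra_simps)
    then have "\<theta> \<bullet> v = M0 * (b \<theta> + a \<theta>) / 2" using width[OF \<theta>] by simp
    then have "b \<theta> + a \<theta> = 2 * (\<theta> \<bullet> z)" using \<open>M0 \<noteq> 0\<close> by (simp add: z_def field_simps)
    then show "a \<theta> = \<theta> \<bullet> z - R" "b \<theta> = \<theta> \<bullet> z + R" using w by linarith+
  qed
  \<comment> \<open>So the domain has the same supporting hyperplanes as the ball of radius \<open>R\<close> about \<open>z\<close>.\<close>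
  have R: "0 < R"
    using ab[of "axis k 1"] interval(2)[of "axis k 1"] by simp
  have "\<Omega> \<subseteq> ball z R"
  proof
    fix x assume x: "x \<in> \<Omega>"
    show "x \<in> ball z R"
    proof (cases "x = z")
      case False
      define \<theta> where "\<theta> = (x - z) /\<^sub>R norm (x - z)"
      have \<theta>: "norm \<theta> = 1" using False by (simp add: \<theta>_def)
      have "\<theta> \<bullet> x < \<theta> \<bullet> z + R" using interval(1)[OF \<theta>] ab[OF \<theta>] x by auto
      moreover have "\<theta> \<bullet> (x - z) = norm (x - z)"
        using False by (simp add: \<theta>_def flip: power2_norm_eq_inner) (simp add: power2_eq_square)
      ultimately show ?thesis by (simp add: inner_diff_right dist_norm norm_minus_commute)
    qed (use R in simp)
  qed
  moreover have "(LINT x:\<Omega> \<inter> {x. R - e < \<theta> \<bullet> (x - z)}|lebesgue. f x) = C * e"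
    if \<theta>: "norm \<theta> = 1" and e: "0 < e" "e < R" for \<theta> e
  proof -
    let ?g = "indicator {b \<theta> - e<..} :: real \<Rightarrow> real"
    have eq: "indicator \<Omega> x *\<^sub>R (f x * ?g (\<theta> \<bullet> x)) = indicator (\<Omega> \<inter> {x. R - e < \<theta> \<bullet> (x - z)}) x *\<^sub>R f x" for x
      by (auto simp: indicator_def ab[OF \<theta>] inner_diff_right)
    have "open {x. R - e < \<theta> \<bullet> (x - z)}" by (intro open_Collect_less continuous_intros)
    then have "set_integrable lebesgue (\<Omega> \<inter> {x. R - e < \<theta> \<bullet> (x - z)}) f"
      using \<open>open \<Omega>\<close> by (intro set_integrable_subset[OF f]) auto
    then have "set_integrable lebesgue \<Omega> (\<lambda>x. f x * ?g (\<theta> \<bullet> x))"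
      unfolding set_integrable_def eq .
    then have "(LINT x:\<Omega>|lebesgue. f x * ?g (\<theta> \<bullet> x)) = C * (LINT t:{a \<theta><..<b \<theta>}|lborel. ?g t)"
      by (intro radon[OF \<theta>]) auto
    also have "(LINT t:{a \<theta><..<b \<theta>}|lborel. ?g t) = e"
      using e ab[OF \<theta>] R interval(2)[OF \<theta>] by (intro integral_open_interval_cases(3)) auto
    finally show ?thesis unfolding set_lebesgue_integral_def eq .
  qed
  ultimately show False
    by (rule cap_integral_contradiction[OF \<open>CARD('n) \<ge> 3\<close> \<open>open \<Omega>\<close> f R _ C])
qed

end
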